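(* Let $(\mathcal{X}_{\mathrm{free}}, \mathbf{x}_{\mathrm{init}}, \mathbf{x}_{\mathrm{goal}})$ be a path planning problem in dimension $d$, let $\delta>0$, and let $\sigma:[0,1]\to\mathcal{X}_{\mathrm{free}}$ be a feasible path with strong $\delta$-clearance. Let $\eta\ge 0$, and for each $n$ run BFMT$^*$ to completion with $n$ samples and connection radius $$r_n = 4\,(1+\eta)^{1/d}\left(\frac1d\right)^{1/d}\left(\frac{\mu(\mathcal{X}_{\mathrm{free}})}{\zeta_d}\right)^{1/d}\left(\frac{\log n}{n}\right)^{1/d}.$$ Let $c_n$ denote the cost of the path returned by BFMT$^*$. Then for every fixed $\varepsilon>0$, as $n\to\infty$, $$\mathbb{P}\big(c_n > (1+\varepsilon)\,c(\sigma)\big) = O\!\left(n^{-\eta/d}\,(\log n)^{-1/d}\right).$$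
   Context: **Path planning problem.** $\mathcal{X}\subset\mathbb{R}^d$ is a $d$-dimensional configuration space and $\mathcal{X}_{\mathrm{obs}}$ is the obstacle region, with $\mathcal{X}\setminus\mathcal{X}_{\mathrm{obs}}$ open and $\partial\mathcal{X}\subset\mathcal{X}_{\mathrm{obs}}$. The free space is $\mathcal{X}_{\mathrm{free}}=\mathrm{cl}(\mathcal{X}\setminus\mathcal{X}_{\mathrm{obs}})$ (closure). $\mu$ is Lebesgue measure, $0<\mu(\mathcal{X}_{\mathrm{free}})<\infty$, and $\zeta_d$ is the volume of the $d$-dimensional Euclidean unit ball. A problem is a triple $(\mathcal{X}_{\mathrm{free}},\mathbf{x}_{\mathrm{init}},\mathbf{x}_{\mathrm{goal}})$ with initial and goal configurations $\mathbf{x}_{\mathrm{init}},\mathbf{x}_{\mathrm{goal}}$. A path is a continuous function $\sigma:[0,1]\to\mathcal{X}$ of bounded variation. It is collision-free if $\sigma(\tau)\in\mathcal{X}_{\mathrm{free}}$ for all $\tau$, and feasible if it is collision-free with $\sigma(0)=\mathbf{x}_{\mathrm{init}}$ and $\sigma(1)=\mathbf{x}_{\mathrm{goal}}$. The cost $c(\sigma)$ is the Euclidean arc length of $\sigma$. The $\delta$-interior of $\mathcal{X}_{\mathrm{free}}$ is the set of its points at distance at least $\delta$ from every point of $\mathcal{X}_{\mathrm{obs}}$. A collision-free path has strong $\delta$-clearance if it lies entirely in the $\delta$-interior of $\mathcal{X}_{\mathrm{free}}$. **Notation for the algorithm.** A tree is a quadruple $T=(V,E,V_{\mathrm{unvisited}},V_{\mathrm{open}})$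 (nodes, edges, unvisited samples, wavefront nodes). $\mathrm{Cost}(\mathbf{x},T)$ is the length of the unique path in $T$ from its root to $\mathbf{x}$, and $\mathrm{Path}(\mathbf{x},T)$ is that path. $\mathrm{Near}(A,\mathbf{z},r)=\{\mathbf{x}\in A:\|\mathbf{x}-\mathbf{z}\|<r\}$. $\mathrm{CollisionFree}(\mathbf{x},\mathbf{y})$ means the straight segment from $\mathbf{x}$ to $\mathbf{y}$ lies in $\mathcal{X}_{\mathrm{free}}$. Ties in minimizations are broken arbitrarily. **Algorithm BFMT$^*$** (inputs $\mathbf{x}_{\mathrm{init}},\mathbf{x}_{\mathrm{goal}},r_n,n$). If $\mathbf{x}_{\mathrm{init}}=\mathbf{x}_{\mathrm{goal}}$, return the trivial path of cost $0$. Otherwise: 1. Let $S=\{\mathbf{x}_{\mathrm{init}},\mathbf{x}_{\mathrm{goal}}\}\cup\{n \text{ i.i.d. uniform samples from }\mathcal{X}_{\mathrm{free}}\}$. Initialize $T$ with root $\mathbf{x}_{\mathrm{init}}$ and $T'$ with root $\mathbf{x}_{\mathrm{goal}}$. A tree initialized with root $\mathbf{x}_0$ has $V=V_{\mathrm{open}}=\{\mathbf{x}_0\}$, $E=\emptyset$, $V_{\mathrm{unvisited}}=S\setminus\{\mathbf{x}_0\}$. Set $\mathbf{z}=\mathbf{x}_{\mathrm{init}}$; the meeting node $\mathbf{x}_{\mathrm{meet}}$ is undefined (its cost is taken to be $\infty$). Repeat steps 2–5. 2. *Expand* $T$ from $\mathbf{z}$: let $Z=\mathrm{Near}(V_{\mathrm{unvisited}},\mathbf{z},r_n)$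 and $V_{\mathrm{new}}=\emptyset$. For each $\mathbf{x}\in Z$, let $\mathbf{x}_{\min}$ minimize $\mathrm{Cost}(\tilde{\mathbf{x}},T)+\|\tilde{\mathbf{x}}-\mathbf{x}\|$ over $\tilde{\mathbf{x}}\in\mathrm{Near}(V_{\mathrm{open}},\mathbf{x},r_n)$. If $\mathrm{CollisionFree}(\mathbf{x}_{\min},\mathbf{x})$, then add $\mathbf{x}$ to $V$ and to $V_{\mathrm{new}}$, add edge $(\mathbf{x}_{\min},\mathbf{x})$ to $E$, and remove $\mathbf{x}$ from $V_{\mathrm{unvisited}}$; moreover, if $\mathbf{x}\in V'$ (the node set of $T'$) and $\mathrm{Cost}(\mathbf{x},T)+\mathrm{Cost}(\mathbf{x},T')<\mathrm{Cost}(\mathbf{x}_{\mathrm{meet}},T)+\mathrm{Cost}(\mathbf{x}_{\mathrm{meet}},T')$, set $\mathbf{x}_{\mathrm{meet}}=\mathbf{x}$. (If the segment is not collision-free, $\mathbf{x}$ is skipped and stays unvisited.) After the loop over $Z$, set $V_{\mathrm{open}}=(V_{\mathrm{open}}\cup V_{\mathrm{new}})\setminus\{\mathbf{z}\}$. 3. If $\mathbf{x}_{\mathrm{meet}}$ is defined, stop and return the concatenation of $\mathrm{Path}(\mathbf{x}_{\mathrm{meet}},T)$ and $\mathrm{Path}(\mathbf{x}_{\mathrm{meet}},T')$, of cost $\mathrm{Cost}(\mathbf{x}_{\mathrm{meet}},T)+\mathrm{Cost}(\mathbf{x}_{\mathrm{meet}},T')$. 4. Otherwise, if the wavefront $V'_{\mathrm{open}}$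 of $T'$ is empty, *Insert* a new sample in $T'$: repeatedly draw fresh independent uniform samples $\mathbf{s}$ from $\mathcal{X}_{\mathrm{free}}$ until some $\mathbf{s}$ has at least one node $\mathbf{x}\in\mathrm{Near}(V',\mathbf{s},r_n)$ with $\mathrm{CollisionFree}(\mathbf{x},\mathbf{s})$. Among such $\mathbf{x}$, connect $\mathbf{s}$ to the one minimizing $\mathrm{Cost}(\mathbf{x},T')+\|\mathbf{x}-\mathbf{s}\|$, adding $\mathbf{s}$ to $V'$ and $V'_{\mathrm{open}}$ and the corresponding edge to $E'$. 5. Let $\mathbf{z}$ minimize $\mathrm{Cost}(\cdot,T')$ over $V'_{\mathrm{open}}$, then swap the roles of $T$ and $T'$. "Run to completion" means there is no external early termination. If no path is ever returned, $c_n=\infty$. The constant implied in $O(\cdot)$ may depend on everything except $n$. *)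

theory Defs
  imports "HOL-Probability.Probability" "HOL-Library.Landau_Symbols"
begin

section \<open>Path planning problems\<close>

definition free_space :: "'a::euclidean_space set \<Rightarrow> 'a set \<Rightarrow> 'a set" where
  "free_space X Xobs = closure (X - Xobs)"

text \<open>Length of the polygonal chain through a list of points (0 for fewer than two points).\<close>

definition polyline_length :: "'a::metric_space list \<Rightarrow> real" where
  "polyline_length p = (\<Sum>i<length p - 1. dist (p ! i) (p ! Suc i))"

text \<open>The lengths of all polygonal chains inscribed in a curve on the unit interval. The curve has
  bounded variation iff these are bounded, and then its arc length is their supremum.\<close>

definition inscribed_lengths :: "(real \<Rightarrow> 'a::metric_space) \<Rightarrow> real set" where
  "inscribed_lengths \<sigma> = {polyline_length (map \<sigma> ts) |ts. sorted ts \<and> set ts \<subseteq> {0..1}}"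

definition bounded_variation :: "(real \<Rightarrow> 'a::metric_space) \<Rightarrow> bool" where
  "bounded_variation \<sigma> \<longleftrightarrow> bdd_above (inscribed_lengths \<sigma>)"

definition arc_length :: "(real \<Rightarrow> 'a::metric_space) \<Rightarrow> real" where
  "arc_length \<sigma> = Sup (inscribed_lengths \<sigma>)"

definition feasible_path ::
  "'a::euclidean_space set \<Rightarrow> 'a set \<Rightarrow> 'a \<Rightarrow> 'a \<Rightarrow> (real \<Rightarrow> 'a) \<Rightarrow> bool" where
  "feasible_path X Xobs xinit xgoal \<sigma> \<longleftrightarrow>
     path \<sigma> \<and> path_image \<sigma> \<subseteq> X \<and> bounded_variation \<sigma> \<and>
     path_image \<sigma> \<subseteq> free_space X Xobs \<and> pathstart \<sigma> = xinit \<and> pathfinish \<sigma> = xgoal"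

definition delta_interior :: "real \<Rightarrow> 'a::euclidean_space set \<Rightarrow> 'a set \<Rightarrow> 'a set" where
  "delta_interior \<delta> X Xobs = {x \<in> free_space X Xobs. \<forall>y\<in>Xobs. \<delta> \<le> dist x y}"

definition strong_clearance ::
  "real \<Rightarrow> 'a::euclidean_space set \<Rightarrow> 'a set \<Rightarrow> (real \<Rightarrow> 'a) \<Rightarrow> bool" where
  "strong_clearance \<delta> X Xobs \<sigma> \<longleftrightarrow> path_image \<sigma> \<subseteq> delta_interior \<delta> X Xobs"


section \<open>Search trees\<close>

text \<open>Edges are directed away from the root: \<open>(u, v)\<close> means that \<open>u\<close> is the parent of \<open>v\<close>.\<close>

record 'a search_tree =
  tree_root :: 'a
  tree_nodes :: "'a set"
  tree_edges :: "('a \<times> 'a) set"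
  tree_unvisited :: "'a set"
  tree_open :: "'a set"

definition init_tree :: "'a set \<Rightarrow> 'a \<Rightarrow> 'a search_tree" where
  "init_tree S x\<^sub>0 = \<lparr>tree_root = x\<^sub>0, tree_nodes = {x\<^sub>0}, tree_edges = {},
     tree_unvisited = S - {x\<^sub>0}, tree_open = {x\<^sub>0}\<rparr>"

definition is_tree_path :: "'a \<Rightarrow> 'a search_tree \<Rightarrow> 'a list \<Rightarrow> bool" where
  "is_tree_path x T p \<longleftrightarrow> p \<noteq> [] \<and> hd p = tree_root T \<and> last p = x \<and>
     successively (\<lambda>u v. (u, v) \<in> tree_edges T) p"

definition path_to :: "'a \<Rightarrow> 'a search_tree \<Rightarrow> 'a list" where
  "path_to x T = (THE p. is_tree_path x T p)"

definition cost_to :: "'a::metric_space \<Rightarrow> 'a search_tree \<Rightarrow> real" where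
  "cost_to x T = polyline_length (path_to x T)"

definition near :: "'a::real_normed_vector set \<Rightarrow> 'a \<Rightarrow> real \<Rightarrow> 'a set" where
  "near A z r = {x \<in> A. norm (x - z) < r}"

definition collision_free :: "'a::real_vector set \<Rightarrow> 'a \<Rightarrow> 'a \<Rightarrow> bool" where
  "collision_free Xfree x y \<longleftrightarrow> closed_segment x y \<subseteq> Xfree"


section \<open>The algorithm\<close>

text \<open>The algorithm is a nondeterministic transition system: ties in minimizations and the order of
  iteration over a set are resolved arbitrarily.\<close>

inductive for_each :: "('x \<Rightarrow> 's \<Rightarrow> 's \<Rightarrow> bool) \<Rightarrow> 'x set \<Rightarrow> 's \<Rightarrow> 's \<Rightarrow> bool"
  for body :: "'x \<Rightarrow> 's \<Rightarrow> 's \<Rightarrow> bool" where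
  finished: "for_each body {} s s"
| iterate: "x \<in> A \<Longrightarrow> body x s s' \<Longrightarrow> for_each body (A - {x}) s' s'' \<Longrightarrow> for_each body A s s''"

text \<open>Cost of the solution through the meeting node; infinite while there is no such node.\<close>

definition meet_cost ::
  "'a::metric_space option \<Rightarrow> 'a search_tree \<Rightarrow> 'a search_tree \<Rightarrow> ereal" where
  "meet_cost xmeet T T' =
     (case xmeet of None \<Rightarrow> \<infinity> | Some x \<Rightarrow> ereal (cost_to x T + cost_to x T'))"

text \<open>Body of the expansion loop. The loop state consists of the expanded tree, the set of newly
  added nodes, and the meeting node; \<open>T'\<close> is the other tree.\<close>

inductive try_connect :: "'a::euclidean_space set \<Rightarrow> real \<Rightarrow> 'a search_tree \<Rightarrow> 'a \<Rightarrow>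
    'a search_tree \<times> 'a set \<times> 'a option \<Rightarrow> 'a search_tree \<times> 'a set \<times> 'a option \<Rightarrow> bool"
  for Xfree :: "'a set" and r :: real and T' :: "'a search_tree" and x :: 'a where
  connect:
    "is_arg_min (\<lambda>y. cost_to y T + norm (y - x)) (\<lambda>y. y \<in> near (tree_open T) x r) xmin \<Longrightarrow>
     collision_free Xfree xmin x \<Longrightarrow>
     T1 = T\<lparr>tree_nodes := insert x (tree_nodes T),
            tree_edges := insert (xmin, x) (tree_edges T),
            tree_unvisited := tree_unvisited T - {x}\<rparr> \<Longrightarrow>
     xmeet1 = (if x \<in> tree_nodes T' \<and>
                  ereal (cost_to x T1 + cost_to x T') < meet_cost xmeet T1 T'
               then Some x else xmeet) \<Longrightarrow>
     try_connect Xfree r T' x (T, Vnew, xmeet) (T1, insert x Vnew, xmeet1)"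
| skip:
    "is_arg_min (\<lambda>y. cost_to y T + norm (y - x)) (\<lambda>y. y \<in> near (tree_open T) x r) xmin \<Longrightarrow>
     \<not> collision_free Xfree xmin x \<Longrightarrow>
     try_connect Xfree r T' x (T, Vnew, xmeet) (T, Vnew, xmeet)"

text \<open>Expansion starts with an undefined meeting node, since the algorithm stops at the end of the
  first expansion that defines it.\<close>

inductive expand :: "'a::euclidean_space set \<Rightarrow> real \<Rightarrow> 'a \<Rightarrow> 'a search_tree \<Rightarrow> 'a search_tree \<Rightarrow>
    'a search_tree \<Rightarrow> 'a option \<Rightarrow> bool"
  for Xfree :: "'a set" and r :: real and z :: 'a and T T' :: "'a search_tree" where
  "for_each (try_connect Xfree r T') (near (tree_unvisited T) z r)
     (T, {}, None) (T1, Vnew, xmeet) \<Longrightarrow>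
   expand Xfree r z T T' (T1\<lparr>tree_open := (tree_open T1 \<union> Vnew) - {z}\<rparr>) xmeet"

text \<open>In \<open>Expanding T T' z k\<close> the tree \<open>T\<close> is about to be expanded from \<open>z\<close>. In \<open>Selecting T T' k\<close> the
  tree \<open>T\<close> has just been expanded without meeting \<open>T'\<close>, and the next node of \<open>T'\<close> is to be chosen,
  after inserting a sample into \<open>T'\<close> if its wavefront is empty. In both, \<open>k\<close> is the index of the next
  fresh sample. \<open>Returned p\<close> holds the returned path as its list of vertices.\<close>

datatype 'a bfmt_state =
  Expanding "'a search_tree" "'a search_tree" 'a nat
| Selecting "'a search_tree" "'a search_tree" nat
| Returned "'a list"

inductive bfmt_step :: "'a::euclidean_space set \<Rightarrow> real \<Rightarrow> (nat \<Rightarrow> 'a) \<Rightarrow>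
    'a bfmt_state \<Rightarrow> 'a bfmt_state \<Rightarrow> bool"
  for Xfree :: "'a set" and r :: real and sample :: "nat \<Rightarrow> 'a" where
  meet:
    "expand Xfree r z T T' T1 (Some x) \<Longrightarrow>
     bfmt_step Xfree r sample
       (Expanding T T' z k) (Returned (path_to x T1 @ tl (rev (path_to x T'))))"
| no_meet:
    "expand Xfree r z T T' T1 None \<Longrightarrow>
     bfmt_step Xfree r sample (Expanding T T' z k) (Selecting T1 T' k)"
| draw_rejected:
    "tree_open T' = {} \<Longrightarrow>
     \<forall>x\<in>near (tree_nodes T') (sample k) r. \<not> collision_free Xfree x (sample k) \<Longrightarrow>
     bfmt_step Xfree r sample (Selecting T T' k) (Selecting T T' (Suc k))"
| draw_inserted:
    "tree_open T' = {} \<Longrightarrow>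
     s = sample k \<Longrightarrow>
     is_arg_min (\<lambda>x. cost_to x T' + norm (x - s))
       (\<lambda>x. x \<in> near (tree_nodes T') s r \<and> collision_free Xfree x s) xmin \<Longrightarrow>
     bfmt_step Xfree r sample (Selecting T T' k)
       (Selecting T (T'\<lparr>tree_nodes := insert s (tree_nodes T'),
                        tree_edges := insert (xmin, s) (tree_edges T'),
                        tree_open := insert s (tree_open T')\<rparr>) (Suc k))"
| select:
    "is_arg_min (\<lambda>x. cost_to x T') (\<lambda>x. x \<in> tree_open T') z \<Longrightarrow>
     bfmt_step Xfree r sample (Selecting T T' k) (Expanding T' T z k)"

text \<open>The first \<open>n\<close> terms of the sample stream form the initial sample set, the later ones are the fresh
  draws made by insertions.\<close>

definition bfmt_start :: "'a \<Rightarrow> 'a \<Rightarrow> nat \<Rightarrow> (nat \<Rightarrow> 'a) \<Rightarrow> 'a bfmt_state" where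
  "bfmt_start xinit xgoal n sample =
     (let S = {xinit, xgoal} \<union> sample ` {..<n}
      in Expanding (init_tree S xinit) (init_tree S xgoal) xinit n)"

text \<open>\<open>bfmt_cost Xfree xinit xgoal r n sample c\<close>: on the given sample stream, some execution has cost
  \<open>c\<close>. An execution that never returns is an infinite sequence of steps and has cost \<open>\<infinity>\<close>.\<close>

definition bfmt_cost ::
  "'a::euclidean_space set \<Rightarrow> 'a \<Rightarrow> 'a \<Rightarrow> real \<Rightarrow> nat \<Rightarrow> (nat \<Rightarrow> 'a) \<Rightarrow> ereal \<Rightarrow> bool" where
  "bfmt_cost Xfree xinit xgoal r n sample c \<longleftrightarrow>
     (if xinit = xgoal then c = 0
      else
        (\<exists>p. (bfmt_step Xfree r sample)\<^sup>*\<^sup>* (bfmt_start xinit xgoal n sample) (Returned p) \<and>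
             c = ereal (polyline_length p)) \<or>
        (\<exists>st. st 0 = bfmt_start xinit xgoal n sample \<and>
              (\<forall>i. bfmt_step Xfree r sample (st i) (st (Suc i))) \<and> c = \<infinity>))"

definition bfmt_radius :: "'a::euclidean_space set \<Rightarrow> real \<Rightarrow> nat \<Rightarrow> real" where
  "bfmt_radius Xfree \<eta> n =
     (let d = real DIM('a) in
      4 * (1 + \<eta>) powr (1 / d) * (1 / d) powr (1 / d) *
      (measure lborel Xfree / unit_ball_vol d) powr (1 / d) *
      (ln (real n) / real n) powr (1 / d))"


section \<open>Every sample stream has an execution\<close>

lemma for_each_invariant_exists:
  assumes "finite A" "I s"
    and "\<And>x s. x \<in> A \<Longrightarrow> I s \<Longrightarrow> \<exists>s'. body x s s' \<and> I s'"
  shows "\<exists>s'. for_each body A s s' \<and> I s'"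
  using assms
proof (induction A arbitrary: s rule: finite_induct)
  case empty
  then show ?case by (auto intro: for_each.finished)
next
  case (insert x A)
  obtain s' where s': "body x s s'" "I s'" using insert.prems by blast
  obtain s'' where "for_each body A s' s''" "I s''" using insert.IH[OF s'(2)] insert.prems by blast
  then show ?case
    using s' insert.hyps for_each.iterate[of x "insert x A" body s s' s''] by auto
qed

definition state_ok :: "'a bfmt_state \<Rightarrow> bool" where
  "state_ok st = (case st of
      Expanding T T' z k \<Rightarrow> finite (tree_nodes T) \<and> finite (tree_unvisited T) \<and> finite (tree_open T) \<and>
        finite (tree_nodes T') \<and> finite (tree_unvisited T') \<and> finite (tree_open T') \<and> z \<in> tree_open T
    | Selecting T T' k \<Rightarrow> finite (tree_nodes T) \<and> finite (tree_unvisited T) \<and> finite (tree_open T) \<and>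
        finite (tree_nodes T') \<and> finite (tree_unvisited T') \<and> finite (tree_open T')
    | Returned p \<Rightarrow> True)"

lemma try_connect_exists:
  fixes T T' :: "'a::euclidean_space search_tree"
  assumes "finite (tree_open T)" "near (tree_open T) x r \<noteq> {}"
  shows "\<exists>T1 V1 m1. try_connect Xfree r T' x (T, V, m) (T1, V1, m1) \<and>
    tree_open T1 = tree_open T \<and> tree_nodes T1 \<subseteq> insert x (tree_nodes T) \<and>
    tree_unvisited T1 \<subseteq> tree_unvisited T \<and> V1 \<subseteq> insert x V"
proof -
  have "finite (near (tree_open T) x r)" using assms(1) by (simp add: near_def)
  then obtain y where y:
    "is_arg_min (\<lambda>y. cost_to y T + norm (y - x)) (\<lambda>y. y \<in> near (tree_open T) x r) y"
    using ex_is_arg_min_if_finite assms(2) by blast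
  show ?thesis
  proof (cases "collision_free Xfree y x")
    case True
    show ?thesis
      by (rule exI, rule exI, rule exI, rule conjI, rule try_connect.connect[OF y True refl refl]) auto
  next
    case False
    show ?thesis
      by (rule exI, rule exI, rule exI, rule conjI, rule try_connect.skip[OF y False]) auto
  qed
qed

lemma expand_exists:
  fixes T T' :: "'a::euclidean_space search_tree"
  assumes "finite (tree_nodes T)" "finite (tree_unvisited T)" "finite (tree_open T)"
    and z: "z \<in> tree_open T"
  shows "\<exists>T1 m. expand Xfree r z T T' T1 m \<and>
    finite (tree_nodes T1) \<and> finite (tree_unvisited T1) \<and> finite (tree_open T1)"
proof -
  define I where "I = (\<lambda>(T1 :: 'a search_tree, V :: 'a set, m :: 'a option). tree_open T1 = tree_open T \<and>
    finite (tree_nodes T1) \<and> finite (tree_unvisited T1) \<and> finite V)"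
  have step: "\<exists>s'. try_connect Xfree r T' x s s' \<and> I s'"
    if x: "x \<in> near (tree_unvisited T) z r" and s: "I s" for x s
  proof -
    obtain T1 V m where sd: "s = (T1, V, m)" by (cases s)
    have o: "tree_open T1 = tree_open T" and fin: "finite (tree_nodes T1)"
      "finite (tree_unvisited T1)" "finite V" using s by (auto simp: I_def sd)
    have "z \<in> near (tree_open T1) x r"
      using x z o by (auto simp: near_def norm_minus_commute)
    then have "near (tree_open T1) x r \<noteq> {}" by blast
    moreover have "finite (tree_open T1)" using assms o by simp
    ultimately obtain T2 V2 m2 where "try_connect Xfree r T' x (T1, V, m) (T2, V2, m2)"
      "tree_open T2 = tree_open T1" "tree_nodes T2 \<subseteq> insert x (tree_nodes T1)"
      "tree_unvisited T2 \<subseteq> tree_unvisited T1" "V2 \<subseteq> insert x V"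
      using try_connect_exists[of T1 x r Xfree T' V m] by blast
    then show ?thesis using o fin unfolding sd
      by (intro exI[of _ "(T2, V2, m2)"]) (auto simp: I_def intro: finite_subset)
  qed
  have "finite (near (tree_unvisited T) z r)" using assms by (simp add: near_def)
  moreover have "I (T, {}, None)" using assms by (simp add: I_def)
  ultimately obtain s where s: "for_each (try_connect Xfree r T') (near (tree_unvisited T) z r)
      (T, {}, None) s" "I s" using for_each_invariant_exists[of _ I] step by metis
  obtain T1 V m where sd: "s = (T1, V, m)" by (cases s)
  show ?thesis
    using expand.intros[OF s(1)[unfolded sd]] s(2) assms by (fastforce simp: I_def sd)
qed

lemma bfmt_step_exists:
  assumes "state_ok st" "\<nexists>p. st = Returned p"
  shows "\<exists>st'. bfmt_step Xfree r sample st st' \<and> state_ok st'"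
proof (cases st)
  case (Expanding T T' z k)
  then obtain T1 m where e: "expand Xfree r z T T' T1 m" "finite (tree_nodes T1)"
    "finite (tree_unvisited T1)" "finite (tree_open T1)"
    using assms(1) expand_exists[of T z Xfree r T'] by (auto simp: state_ok_def)
  show ?thesis
  proof (cases m)
    case None
    show ?thesis unfolding Expanding
      by (rule exI, rule conjI, rule bfmt_step.no_meet[OF e(1)[unfolded None]])
        (use assms(1) e Expanding in \<open>auto simp: state_ok_def\<close>)
  next
    case (Some x)
    show ?thesis unfolding Expanding
      by (rule exI, rule conjI, rule bfmt_step.meet[OF e(1)[unfolded Some]])
        (auto simp: state_ok_def)
  qed
next
  case (Selecting T T' k)
  have fin: "finite (tree_open T')" "finite (tree_nodes T')"
    using assms(1) Selecting by (auto simp: state_ok_def)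
  show ?thesis
  proof (cases "tree_open T' = {}")
    case False
    then obtain z where z: "is_arg_min (\<lambda>x. cost_to x T') (\<lambda>x. x \<in> tree_open T') z"
      using ex_is_arg_min_if_finite fin by blast
    show ?thesis unfolding Selecting
      by (rule exI, rule conjI, rule bfmt_step.select[OF z])
        (use assms(1) z Selecting in \<open>auto simp: state_ok_def is_arg_min_def\<close>)
  next
    case True
    let ?N = "{x \<in> near (tree_nodes T') (sample k) r. collision_free Xfree x (sample k)}"
    show ?thesis
    proof (cases "?N = {}")
      case N: True
      show ?thesis unfolding Selecting
        by (rule exI, rule conjI, rule bfmt_step.draw_rejected[OF True])
          (use N assms(1) Selecting in \<open>auto simp: state_ok_def\<close>)
    next
      case False
      moreover have "finite ?N" using fin by (simp add: near_def)
      ultimately obtain x where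
        "is_arg_min (\<lambda>x. cost_to x T' + norm (x - sample k)) (\<lambda>x. x \<in> ?N) x"
        using ex_is_arg_min_if_finite by blast
      then have x: "is_arg_min (\<lambda>x. cost_to x T' + norm (x - sample k))
        (\<lambda>x. x \<in> near (tree_nodes T') (sample k) r \<and> collision_free Xfree x (sample k)) x" by simp
      show ?thesis unfolding Selecting
        by (rule exI, rule conjI, rule bfmt_step.draw_inserted[where sample = sample and k = k, OF True refl x])
          (use assms(1) Selecting in \<open>auto simp: state_ok_def\<close>)
    qed
  qed
qed (use assms in auto)

lemma bfmt_cost_exists: "\<exists>c. bfmt_cost Xfree xinit xgoal r n sample c"
proof (cases "xinit = xgoal")
  case False
  let ?s0 = "bfmt_start xinit xgoal n sample" and ?R = "bfmt_step Xfree r sample"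
  show ?thesis
  proof (cases "\<exists>p. ?R\<^sup>*\<^sup>* ?s0 (Returned p)")
    case True
    then show ?thesis using False by (auto simp: bfmt_cost_def)
  next
    case no: False
    have "\<exists>st. st 0 = ?s0 \<and> (\<forall>i. (?R\<^sup>*\<^sup>* ?s0 (st i) \<and> state_ok (st i)) \<and> ?R (st i) (st (Suc i)))"
    proof -
      have "\<exists>st. \<forall>i. (?R\<^sup>*\<^sup>* ?s0 (st i) \<and> state_ok (st i) \<and> (i = 0 \<longrightarrow> st i = ?s0)) \<and>
          ?R (st i) (st (Suc i))"
      proof (rule dependent_nat_choice)
        show "\<exists>x. ?R\<^sup>*\<^sup>* ?s0 x \<and> state_ok x \<and> (0 = (0::nat) \<longrightarrow> x = ?s0)"
          by (rule exI[of _ ?s0]) (auto simp: bfmt_start_def init_tree_def state_ok_def Let_def)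
      next
        fix x :: "'a bfmt_state" and i :: nat
        assume x: "?R\<^sup>*\<^sup>* ?s0 x \<and> state_ok x \<and> (i = 0 \<longrightarrow> x = ?s0)"
        then have "\<nexists>p. x = Returned p" using no by auto
        then obtain y where "?R x y" "state_ok y" using bfmt_step_exists x by blast
        then show "\<exists>y. (?R\<^sup>*\<^sup>* ?s0 y \<and> state_ok y \<and> (Suc i = 0 \<longrightarrow> y = ?s0)) \<and> ?R x y"
          using x by (intro exI[of _ y]) (auto intro: rtranclp.rtrancl_into_rtrancl)
      qed
      then show ?thesis by blast
    qed
    then show ?thesis using False by (auto simp: bfmt_cost_def)
  qed
qed (auto simp: bfmt_cost_def)


section \<open>Outer probability\<close>

text \<open>With arbitrary tie-breaking the returned cost need not be a measurable function of the
  outcome. Since \<open>measure\<close> is 0 on nonmeasurable sets, the probability of an event about the cost is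
  taken as outer probability, which is the usual probability on measurable events.\<close>

definition outer_prob :: "'w measure \<Rightarrow> 'w set \<Rightarrow> real" where
  "outer_prob M A = enn2real (outer_measure_of M A)"

lemma outer_prob_eq_measure: "A \<in> sets M \<Longrightarrow> outer_prob M A = measure M A"
  by (simp add: outer_prob_def measure_def)

end

theory Submission
  imports Defs
begin

text \<open>Suppose that some initial samples form a chain from \<open>xinit\<close> to \<open>xgoal\<close> with steps shorter than
  \<open>r\<close>, close enough to \<open>\<sigma>\<close> for all connections to its points to be collision-free. As long as the two
  trees are disjoint, each contains an initial piece of the chain (seen from its root), whose last point
  is open and no costlier than the piece. Hence no wavefront ever becomes empty, the trees meet, and at
  that moment the last expanded nodes of both trees together cost at most the length of the chain; every
  node costs at most \<open>r\<close> more than the last expanded node of its tree, so the returned path exceeds the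
  chain by at most \<open>2 r\<close>.

  To find the chain, choose on \<open>\<sigma>\<close> a sequence of \<open>N = O(1 / r)\<close> waypoints with spacing \<open>r / 4\<close>. Some ball
  of radius \<open>r / 4\<close> around a waypoint contains no sample with probability at most
  \<open>N n powr (- (1 + \<eta>) / d)\<close>, which is the claimed rate. Otherwise there is a chain, and it is short unless a
  fixed fraction \<open>\<beta>\<close> of the balls of radius \<open>\<beta> r\<close> is empty. Half of these have the same parity and are
  disjoint, so by a union bound over sets of waypoints this has probability at most
  \<open>(2 n powr - \<kappa>) ^ N\<close> for some \<open>\<kappa> > 0\<close>, which is negligible because \<open>N\<close> tends to infinity.\<close>

section \<open>Lengths of chains\<close>

definition chain_length :: "(nat \<Rightarrow> 'a::metric_space) \<Rightarrow> nat \<Rightarrow> real" where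
  "chain_length y j = (\<Sum>k<j. dist (y k) (y (Suc k)))"

lemma chain_length_nonneg: "0 \<le> chain_length y j"
  by (simp add: chain_length_def sum_nonneg)

lemma chain_length_mono: "i \<le> j \<Longrightarrow> chain_length y i \<le> chain_length y j"
  unfolding chain_length_def by (rule sum_mono2) auto

lemma dist_le_chain_length:
  assumes "i \<le> j"
  shows "dist (y i) (y j) \<le> chain_length y j - chain_length y i"
  using assms
proof (induction j rule: dec_induct)
  case (step j)
  have "dist (y i) (y (Suc j)) \<le> dist (y i) (y j) + dist (y j) (y (Suc j))" by (rule dist_triangle)
  then show ?case using step by (simp add: chain_length_def)
qed simp

text \<open>Converts costs in the tree rooted at the goal, which follows the reversed chain, into
  lengths along the original chain.\<close>

lemma chain_length_reverse:
  assumes "\<And>i. i \<le> N \<Longrightarrow> y' i = y (N - i)" "j \<le> N"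
  shows "chain_length y' j = chain_length y N - chain_length y (N - j)"
  using assms(2)
proof (induction j)
  case (Suc j)
  have "N - j = Suc (N - Suc j)" using Suc.prems by simp
  then show ?case using Suc assms(1)[of j] assms(1)[of "Suc j"]
    by (simp add: chain_length_def dist_commute)
qed (simp add: chain_length_def)

lemma polyline_length_simps [simp]:
  "polyline_length [] = 0" "polyline_length [x] = 0"
  "polyline_length (x # y # p) = dist x y + polyline_length (y # p)"
  unfolding polyline_length_def by (auto simp: sum.lessThan_Suc_shift simp del: sum.lessThan_Suc)

lemma polyline_length_append:
  "p \<noteq> [] \<Longrightarrow> polyline_length (p @ q) = polyline_length p + polyline_length (last p # q)"
  by (induction p rule: induct_list012) auto

lemma polyline_length_rev: "polyline_length (rev p) = polyline_length p"
proof (induction p rule: induct_list012)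
  case (3 x y p)
  then show ?case
    using polyline_length_append[of "rev (y # p)" "[x]"] by (simp add: dist_commute)
qed auto

text \<open>This is the shape of a returned path: both root paths end at the meeting node, and
  \<open>tl\<close> drops its second copy.\<close>

lemma polyline_length_join:
  assumes "p \<noteq> []" "q \<noteq> []" "last p = last q"
  shows "polyline_length (p @ tl (rev q)) = polyline_length p + polyline_length q"
proof -
  have "rev q = last q # tl (rev q)" using assms by (cases q rule: rev_cases) auto
  then show ?thesis
    using polyline_length_append[OF assms(1), of "tl (rev q)"] assms(3)
    by (metis polyline_length_rev)
qed

section \<open>Paths in search trees\<close>

text \<open>Uniqueness of root paths is the form of being a tree that the definite description in
  \<open>path_to\<close> needs.\<close>

definition tree_wf :: "'a search_tree \<Rightarrow> bool" where
  "tree_wf T \<longleftrightarrow> tree_root T \<in> tree_nodes T \<and> tree_edges T \<subseteq> tree_nodes T \<times> tree_nodes T \<and>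
     (\<forall>x\<in>tree_nodes T. \<exists>!p. is_tree_path x T p)"

lemma is_tree_path_path_to:
  assumes "tree_wf T" "x \<in> tree_nodes T"
  shows "is_tree_path x T (path_to x T)"
  using assms theI'[of "is_tree_path x T"] by (auto simp: tree_wf_def path_to_def)

lemma path_to_eqI:
  assumes "tree_wf T" "x \<in> tree_nodes T" "is_tree_path x T p"
  shows "path_to x T = p"
  using assms is_tree_path_path_to[OF assms(1,2)] by (auto simp: tree_wf_def)

text \<open>No edge leaves \<open>x\<close>: the edges of \<open>E\<close> start in
  \<open>V\<close>, and \<open>u\<close> differs from \<open>x\<close>. A walk that uses the edge
  into \<open>x\<close> therefore ends there.\<close>

lemma successively_insert_leaf:
  assumes "successively (\<lambda>a b. (a, b) \<in> insert (u, x) E) p" "E \<subseteq> V \<times> V" "x \<notin> V" "u \<in> V"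
    "p \<noteq> [] \<Longrightarrow> last p \<noteq> x"
  shows "successively (\<lambda>a b. (a, b) \<in> E) p"
  using assms
proof (induction p rule: induct_list012)
  case (3 a b p)
  then have s: "successively (\<lambda>a b. (a, b) \<in> E) (b # p)" by auto
  have "b \<noteq> x" using s 3 by (cases p) auto
  then show ?case using s 3 by auto
qed auto

text \<open>The new leaf has no outgoing edge, so root paths to old nodes do not change, and the
  only root path to the leaf extends that of its parent \<open>u\<close>.\<close>

lemma
  assumes wf: "tree_wf T" and u: "u \<in> tree_nodes T" and x: "x \<notin> tree_nodes T"
    and T1: "tree_root T1 = tree_root T" "tree_nodes T1 = insert x (tree_nodes T)"
      "tree_edges T1 = insert (u, x) (tree_edges T)"
  shows tree_wf_insert_leaf: "tree_wf T1"
    and cost_to_insert_leaf: "v \<in> tree_nodes T \<Longrightarrow> cost_to v T1 = cost_to v T"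
    and cost_to_leaf: "cost_to x T1 = cost_to u T + dist u x"
proof -
  have root: "tree_root T \<in> tree_nodes T" and edges: "tree_edges T \<subseteq> tree_nodes T \<times> tree_nodes T"
    using wf by (auto simp: tree_wf_def)
  have old: "is_tree_path v T1 p \<longleftrightarrow> is_tree_path v T p" if v: "v \<in> tree_nodes T" for v p
  proof
    assume "is_tree_path v T1 p"
    then show "is_tree_path v T p"
      using successively_insert_leaf[OF _ edges x u, of p] v x
      unfolding is_tree_path_def T1 by auto
  qed (auto simp: is_tree_path_def T1 elim: successively_mono)
  have new: "is_tree_path x T1 p \<longleftrightarrow> (\<exists>q. p = q @ [x] \<and> is_tree_path u T q)" for p
  proof
    assume p: "is_tree_path x T1 p"
    define q where "q = butlast p"
    have pq: "p = q @ [x]" using p unfolding q_def is_tree_path_def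
      by (metis append_butlast_last_id)
    have "q \<noteq> []" using p root x by (auto simp: pq is_tree_path_def T1)
    then have s: "successively (\<lambda>a b. (a, b) \<in> insert (u, x) (tree_edges T)) q"
      and l: "(last q, x) \<in> insert (u, x) (tree_edges T)"
      using p by (auto simp: is_tree_path_def pq T1 successively_append_iff)
    from l have l: "last q = u" using edges x by auto
    then have "successively (\<lambda>a b. (a, b) \<in> tree_edges T) q"
      using successively_insert_leaf[OF s edges x u] u x by auto
    then show "\<exists>q. p = q @ [x] \<and> is_tree_path u T q"
      using p \<open>q \<noteq> []\<close> l by (auto simp: pq is_tree_path_def T1)
  next
    assume "\<exists>q. p = q @ [x] \<and> is_tree_path u T q"
    then show "is_tree_path x T1 p"
      by (auto simp: is_tree_path_def T1 successively_append_iff elim: successively_mono)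
  qed
  show wf1: "tree_wf T1"
    unfolding tree_wf_def
  proof (intro conjI ballI)
    fix v assume "v \<in> tree_nodes T1"
    then consider "v \<in> tree_nodes T" | "v = x" by (auto simp: T1)
    then show "\<exists>!p. is_tree_path v T1 p"
    proof cases
      case 1 then show ?thesis using wf by (simp add: old tree_wf_def)
    next
      case 2
      have "\<exists>!p. is_tree_path u T p" using wf u by (simp add: tree_wf_def)
      then show ?thesis by (auto simp: new 2)
    qed
  qed (use root edges u in \<open>auto simp: T1\<close>)
  show "cost_to v T1 = cost_to v T" if "v \<in> tree_nodes T"
    using that by (simp add: cost_to_def path_to_def old)
  have pu: "is_tree_path u T (path_to u T)" using is_tree_path_path_to[OF wf u] .
  have "path_to x T1 = path_to u T @ [x]"
    by (rule path_to_eqI[OF wf1]) (use pu in \<open>auto simp: new T1\<close>)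
  moreover have "path_to u T \<noteq> []" "last (path_to u T) = u" using pu by (auto simp: is_tree_path_def)
  ultimately show "cost_to x T1 = cost_to u T + dist u x"
    by (simp add: cost_to_def polyline_length_append)
qed

section \<open>Runs of the algorithm near a chain of samples\<close>

text \<open>The invariant is indexed by the set of elements still to be processed, since the loop
  visits them in an arbitrary order.\<close>

lemma for_each_invariant:
  assumes "for_each body A s s'" "I A s"
    and "\<And>A x s s'. x \<in> A \<Longrightarrow> body x s s' \<Longrightarrow> I A s \<Longrightarrow> I (A - {x}) s'"
  shows "I {} s'"
  using assms by (induction rule: for_each.induct) blast+

text \<open>The second condition ranges over all points \<open>v\<close> because the parent of a
  chain point may be any open node, not only another chain point.\<close>

definition chain_safe :: "'a::euclidean_space set \<Rightarrow> real \<Rightarrow> nat \<Rightarrow> (nat \<Rightarrow> 'a) \<Rightarrow> bool" where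
  "chain_safe F r N y \<longleftrightarrow> (\<forall>i<N. dist (y i) (y (Suc i)) < r) \<and>
     (\<forall>i\<le>N. \<forall>v. dist v (y i) < r \<longrightarrow> collision_free F v (y i))"

text \<open>The parameter \<open>h\<close> is the cost of the node from which \<open>T\<close> was last expanded.\<close>

definition tree_inv ::
  "real \<Rightarrow> nat \<Rightarrow> (nat \<Rightarrow> 'a::euclidean_space) \<Rightarrow> real \<Rightarrow> 'a search_tree \<Rightarrow> bool" where
  "tree_inv r N y h T \<longleftrightarrow> tree_wf T \<and> 0 \<le> h \<and>
     finite (tree_unvisited T) \<and> finite (tree_open T) \<and>
     tree_open T \<subseteq> tree_nodes T \<and> tree_nodes T \<inter> tree_unvisited T = {} \<and>
     y ` {..N} \<subseteq> tree_nodes T \<union> tree_unvisited T \<and> y 0 \<in> tree_nodes T \<and>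
     (\<forall>v\<in>tree_nodes T. cost_to v T \<le> h + r) \<and> (\<forall>v\<in>tree_open T. h \<le> cost_to v T) \<and>
     (\<forall>j\<le>N. y j \<in> tree_nodes T \<longrightarrow> cost_to (y j) T \<le> chain_length y j) \<and>
     (\<forall>j<N. y j \<in> tree_nodes T - tree_open T \<longrightarrow> y (Suc j) \<in> tree_nodes T)"

text \<open>Take the first chain point outside the tree. Its predecessor is in the tree and must be
  open, since the successor of a closed chain point is already in the tree.\<close>

lemma tree_inv_open_before_gap:
  assumes inv: "tree_inv r N y h T" and j: "j \<le> N" "y j \<notin> tree_nodes T"
  obtains i where "i < j" "\<And>k. k \<le> i \<Longrightarrow> y k \<in> tree_nodes T" "y (Suc i) \<notin> tree_nodes T"
    "y i \<in> tree_open T" "cost_to (y i) T \<le> chain_length y i"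
proof -
  define m where "m = (LEAST k. y k \<notin> tree_nodes T)"
  have m: "y m \<notin> tree_nodes T" "m \<le> j"
    unfolding m_def using j LeastI[of "\<lambda>k. y k \<notin> tree_nodes T" j] by (auto intro: Least_le)
  have below: "y k \<in> tree_nodes T" if "k < m" for k
    using not_less_Least[of k "\<lambda>k. y k \<notin> tree_nodes T"] that by (auto simp: m_def)
  have "m \<noteq> 0" using m inv by (auto simp: tree_inv_def intro: gr0I)
  then obtain i where i: "m = Suc i" using not0_implies_Suc by blast
  have "i < N" "y i \<in> tree_nodes T" using below[of i] i m j by auto
  then show thesis using that[of i] below m i inv by (auto simp: tree_inv_def)
qed

section \<open>A single expansion of one tree\<close>

definition expansion_inv where
  "expansion_inv r N y z T T' A s \<longleftrightarrow> (case s of (T1, Vnew, m) \<Rightarrow>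
     tree_open T1 = tree_open T \<and> tree_wf T1 \<and>
     tree_nodes T1 = tree_nodes T \<union> Vnew \<and> tree_unvisited T1 = tree_unvisited T - Vnew \<and>
     Vnew \<subseteq> tree_unvisited T \<and> A \<subseteq> near (tree_unvisited T) z r - Vnew \<and>
     (\<forall>v\<in>tree_nodes T. cost_to v T1 = cost_to v T) \<and>
     (\<forall>v\<in>Vnew. cost_to z T \<le> cost_to v T1 \<and> cost_to v T1 \<le> cost_to z T + r \<and>
        (\<forall>j\<le>N. y j = v \<longrightarrow> cost_to v T1 \<le> chain_length y j)) \<and>
     (\<forall>j\<le>N. y j \<in> near (tree_unvisited T) z r \<longrightarrow> y j \<in> A \<union> Vnew) \<and>
     (case m of None \<Rightarrow> tree_nodes T1 \<inter> tree_nodes T' = {} | Some w \<Rightarrow> w \<in> tree_nodes T1 \<inter> tree_nodes T'))"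

text \<open>In \<open>expansion_inv\<close>, \<open>T\<close> is the tree before the loop and
  \<open>A\<close> holds the samples still to be processed. Parents come from the old wavefront,
  where \<open>z\<close> is cheapest and itself a candidate, so new costs lie between the cost of
  \<open>z\<close> and \<open>r\<close> more. A chain point is never skipped, because all short
  segments to it are collision-free.\<close>

lemma try_connect_expansion_inv:
  fixes T T' :: "'a::euclidean_space search_tree"
  assumes inv: "tree_inv r N y h T" and safe: "chain_safe F r N y"
    and z: "is_arg_min (\<lambda>x. cost_to x T) (\<lambda>x. x \<in> tree_open T) z"
    and x: "x \<in> A" and step: "try_connect F r T' x s s'" and I: "expansion_inv r N y z T T' A s"
  shows "expansion_inv r N y z T T' (A - {x}) s'"
proof -
  obtain T1 V m where s: "s = (T1, V, m)" by (cases s)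
  note I = I[unfolded expansion_inv_def s prod.case]
  have xz: "x \<in> tree_unvisited T" "norm (x - z) < r" "x \<notin> V"
    using I x by (auto simp: near_def)
  have xT1: "x \<notin> tree_nodes T1" using I xz inv by (auto simp: tree_inv_def)
  have zo: "z \<in> tree_open T" and zmin: "\<And>v. v \<in> tree_open T \<Longrightarrow> cost_to z T \<le> cost_to v T"
    using z by (auto simp: is_arg_min_linorder)
  have opn: "tree_open T \<subseteq> tree_nodes T" using inv by (simp add: tree_inv_def)
  from step[unfolded s] show ?thesis
  proof (cases rule: try_connect.cases)
    case (connect xmin T2 xmeet1)
    have xm: "xmin \<in> tree_open T" "norm (xmin - x) < r"
      and xmin: "\<And>v. v \<in> tree_open T \<Longrightarrow> norm (v - x) < r \<Longrightarrow>
        cost_to xmin T + norm (xmin - x) \<le> cost_to v T + norm (v - x)"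
      using connect(2) I opn by (auto simp: is_arg_min_linorder near_def subset_iff)
    have u: "xmin \<in> tree_nodes T1" and cu: "cost_to xmin T1 = cost_to xmin T"
      using xm opn I by auto
    have T2: "tree_root T2 = tree_root T1" "tree_nodes T2 = insert x (tree_nodes T1)"
      "tree_edges T2 = insert (xmin, x) (tree_edges T1)"
      "tree_unvisited T2 = tree_unvisited T1 - {x}" "tree_open T2 = tree_open T1"
      by (simp_all add: connect)
    have wf1: "tree_wf T1" using I by simp
    note leaf = tree_wf_insert_leaf[OF wf1 u xT1 T2(1-3)] cost_to_insert_leaf[OF wf1 u xT1 T2(1-3)]
      cost_to_leaf[OF wf1 u xT1 T2(1-3)]
    have cx: "cost_to x T2 = cost_to xmin T + norm (xmin - x)"
      using leaf(3) cu by (simp add: dist_norm)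
    have low: "cost_to z T \<le> cost_to x T2" using zmin[OF xm(1)] cx norm_ge_zero[of "xmin - x"] by linarith
    have zup: "cost_to x T2 \<le> cost_to z T + norm (x - z)"
      using xmin[OF zo] xz cx by (simp add: norm_minus_commute)
    have up: "cost_to x T2 \<le> cost_to z T + r" using zup xz by simp
    have chain: "cost_to x T2 \<le> chain_length y j" if j: "j \<le> N" "y j = x" for j
    proof -
      have "y j \<notin> tree_nodes T" using xT1 I j by auto
      then obtain i where i: "i < j" "y i \<in> tree_open T" "cost_to (y i) T \<le> chain_length y i"
        using tree_inv_open_before_gap[OF inv j(1)] by metis
      have d: "norm (y i - x) \<le> chain_length y j - chain_length y i"
        using dist_le_chain_length[of i j y] i j by (simp add: dist_norm)
      \<comment> \<open>The open chain point \<open>y i\<close> is a candidate parent of \<open>x\<close>; if it is too far away, then the chain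
        is at least \<open>r\<close> longer at \<open>x\<close>, which pays for the edge from \<open>z\<close>.\<close>
      show ?thesis
      proof (cases "norm (y i - x) < r")
        case True
        then show ?thesis using xmin[OF i(2)] cx i d by simp
      next
        case False
        then show ?thesis using zup xz zmin[OF i(2)] i d by linarith
      qed
    qed
    have meet: "case xmeet1 of None \<Rightarrow> tree_nodes T2 \<inter> tree_nodes T' = {}
        | Some w \<Rightarrow> w \<in> tree_nodes T2 \<inter> tree_nodes T'"
      using I connect(5) by (auto simp: T2 meet_cost_def connect split: option.splits if_splits)
    show ?thesis
      unfolding connect(1) expansion_inv_def prod.case
    proof (intro conjI)
      show "\<forall>v\<in>insert x V. cost_to z T \<le> cost_to v T2 \<and> cost_to v T2 \<le> cost_to z T + r \<and>
        (\<forall>j\<le>N. y j = v \<longrightarrow> cost_to v T2 \<le> chain_length y j)"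
        using low up chain I leaf(2) by auto
    qed (use I leaf meet xz in \<open>auto simp: T2\<close>)
  next
    case (skip xmin)
    have xm: "xmin \<in> near (tree_open T) x r"
      using skip(2) I by (auto simp: is_arg_min_linorder)
    have "y j \<noteq> x" if "j \<le> N" for j
      using safe xm skip(3) that by (auto simp: chain_safe_def near_def dist_norm)
    then show ?thesis
      unfolding skip(1) expansion_inv_def prod.case using I by auto
  qed
qed

text \<open>The level rises from \<open>h\<close> to the cost of \<open>z\<close>, which is at least
  \<open>h\<close> because \<open>z\<close> was open; so the upper bound on the costs of old nodes
  persists. The sum of cardinalities falls because new nodes only move from the unvisited samples to
  the wavefront while \<open>z\<close> leaves it.\<close>

lemma expand_tree_inv:
  fixes T T' :: "'a::euclidean_space search_tree"
  assumes inv: "tree_inv r N y h T" and safe: "chain_safe F r N y"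
    and z: "is_arg_min (\<lambda>x. cost_to x T) (\<lambda>x. x \<in> tree_open T) z"
    and disj: "tree_nodes T \<inter> tree_nodes T' = {}"
    and ex: "expand F r z T T' T1 m"
  shows "tree_inv r N y (cost_to z T) T1"
    and "m = None \<Longrightarrow> tree_nodes T1 \<inter> tree_nodes T' = {}"
    and "m = Some w \<Longrightarrow> w \<in> tree_nodes T1 \<inter> tree_nodes T'"
    and "card (tree_unvisited T1) + card (tree_open T1) < card (tree_unvisited T) + card (tree_open T)"
proof -
  obtain T2 V where fe: "for_each (try_connect F r T') (near (tree_unvisited T) z r) (T, {}, None) (T2, V, m)"
    and T1: "T1 = T2\<lparr>tree_open := (tree_open T2 \<union> V) - {z}\<rparr>"
    using ex by (auto elim: expand.cases)
  have inv': "tree_wf T" "0 \<le> h" "finite (tree_unvisited T)" "finite (tree_open T)"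
     "tree_open T \<subseteq> tree_nodes T" "tree_nodes T \<inter> tree_unvisited T = {}"
     "y ` {..N} \<subseteq> tree_nodes T \<union> tree_unvisited T" "y 0 \<in> tree_nodes T"
     "\<And>v. v\<in>tree_nodes T \<Longrightarrow> cost_to v T \<le> h + r" "\<And>v. v\<in>tree_open T \<Longrightarrow> h \<le> cost_to v T"
     "\<And>j. j\<le>N \<Longrightarrow> y j \<in> tree_nodes T \<Longrightarrow> cost_to (y j) T \<le> chain_length y j"
     "\<And>j. j<N \<Longrightarrow> y j \<in> tree_nodes T - tree_open T \<Longrightarrow> y (Suc j) \<in> tree_nodes T"
    using inv by (auto simp: tree_inv_def)
  have "expansion_inv r N y z T T' (near (tree_unvisited T) z r) (T, {}, None)"
    using inv' disj by (auto simp: expansion_inv_def)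
  from for_each_invariant[of _ _ _ _ "expansion_inv r N y z T T'", OF fe this
      try_connect_expansion_inv[OF inv safe z]]
  have "expansion_inv r N y z T T' {} (T2, V, m)" .
  note I = this[unfolded expansion_inv_def prod.case]
  have zo: "z \<in> tree_open T" and zmin: "\<And>v. v \<in> tree_open T \<Longrightarrow> cost_to z T \<le> cost_to v T"
    using z by (auto simp: is_arg_min_linorder)
  have hz: "h \<le> cost_to z T" using inv' zo by simp
  have zV: "z \<notin> V" using zo inv' I by auto
  have T1s: "tree_nodes T1 = tree_nodes T \<union> V" "tree_open T1 = (tree_open T \<union> V) - {z}"
    "tree_unvisited T1 = tree_unvisited T - V" using I by (auto simp: T1)
  have path_same: "path_to v T1 = path_to v T2" for v
    by (simp add: T1 path_to_def is_tree_path_def)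
  have cost1: "cost_to v T1 = cost_to v T2" for v by (simp add: cost_to_def path_same)
  have "tree_wf T2" using I by simp
  then have wf: "tree_wf T1" by (simp add: tree_wf_def T1 is_tree_path_def)
  have finV: "finite V" using I inv' finite_subset by auto
  show "tree_inv r N y (cost_to z T) T1"
    unfolding tree_inv_def
  proof (intro conjI ballI allI impI)
    show "tree_wf T1" by (rule wf)
    show "0 \<le> cost_to z T" using inv' hz by simp
    show "finite (tree_unvisited T1)" "finite (tree_open T1)" using inv' finV by (auto simp: T1s)
    show "tree_open T1 \<subseteq> tree_nodes T1" using inv' by (auto simp: T1s)
    show "tree_nodes T1 \<inter> tree_unvisited T1 = {}" using inv' by (auto simp: T1s)
    show "y ` {..N} \<subseteq> tree_nodes T1 \<union> tree_unvisited T1" using inv' by (auto simp: T1s)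
    show "y 0 \<in> tree_nodes T1" using inv' by (auto simp: T1s)
    show "cost_to v T1 \<le> cost_to z T + r" if "v \<in> tree_nodes T1" for v
      using that I inv'(9)[of v] hz by (auto simp: T1s cost1)
    show "cost_to z T \<le> cost_to v T1" if "v \<in> tree_open T1" for v
      using that I zmin[of v] inv'(5) by (auto simp: T1s cost1)
    show "cost_to (y j) T1 \<le> chain_length y j" if "j \<le> N" "y j \<in> tree_nodes T1" for j
      using that I inv'(11)[of j] by (auto simp: T1s cost1)
    show "y (Suc j) \<in> tree_nodes T1" if j: "j < N" "y j \<in> tree_nodes T1 - tree_open T1" for j
    \<comment> \<open>Only \<open>z\<close> is closed now. If it is a chain point, its successor is
      closer than \<open>r\<close>, hence already in the tree or reached by this expansion.\<close>
    proof (cases "y j = z")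
      case True
      have "dist (y j) (y (Suc j)) < r" using safe j by (simp add: chain_safe_def)
      then have "norm (y (Suc j) - z) < r" using True by (simp add: dist_norm norm_minus_commute)
      moreover have "y (Suc j) \<in> tree_nodes T \<union> tree_unvisited T"
        using subsetD[OF inv'(7) imageI[of "Suc j" "{..N}" y]] j by simp
      ultimately show ?thesis using I j by (auto simp: T1s near_def Suc_le_eq)
    next
      case False
      then show ?thesis using j inv'(12)[of j] by (auto simp: T1s)
    qed
  qed
  show "m = None \<Longrightarrow> tree_nodes T1 \<inter> tree_nodes T' = {}" using I by (auto simp: T1)
  show "m = Some w \<Longrightarrow> w \<in> tree_nodes T1 \<inter> tree_nodes T'" using I by (auto simp: T1)
  have VU: "V \<subseteq> tree_unvisited T" using I by simp
  have "card (tree_unvisited T1) = card (tree_unvisited T) - card V"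
    using VU finV by (simp add: T1s card_Diff_subset)
  moreover have "card V \<le> card (tree_unvisited T)" using VU inv' by (simp add: card_mono)
  moreover have "card (tree_open T1) = card (tree_open T \<union> V) - 1"
    using zo inv' finV by (simp add: T1s)
  moreover have "card (tree_open T \<union> V) \<le> card (tree_open T) + card V" by (rule card_Un_le)
  moreover have "card (tree_open T) > 0" using zo inv' by (auto simp: card_gt_0_iff)
  ultimately show "card (tree_unvisited T1) + card (tree_open T1) < card (tree_unvisited T) + card (tree_open T)"
    by linarith
qed

section \<open>The run as a whole: invariant, termination and cost\<close>

definition state_inv ::
  "'a::euclidean_space set \<Rightarrow> real \<Rightarrow> nat \<Rightarrow> real \<Rightarrow> 'a bfmt_state \<Rightarrow> bool" where
  "state_inv F r N L st \<longleftrightarrow> (case st of Returned p \<Rightarrow> polyline_length p \<le> L + 2 * r | _ \<Rightarrow>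
     (\<exists>y y' h h' T T'. chain_safe F r N y \<and> chain_safe F r N y' \<and> chain_length y N = L \<and>
        (\<forall>i\<le>N. y' i = y (N - i)) \<and> tree_inv r N y h T \<and> tree_inv r N y' h' T' \<and>
        tree_nodes T \<inter> tree_nodes T' = {} \<and>
        ((\<exists>z k. st = Expanding T T' z k \<and> is_arg_min (\<lambda>x. cost_to x T) (\<lambda>x. x \<in> tree_open T) z) \<or>
         (\<exists>k. st = Selecting T T' k))))"

text \<open>The doubling leaves room for selection: an expansion lowers twice the sum by at least
  two and then adds one, and selecting the next node removes this extra one.\<close>

definition state_rank :: "'a bfmt_state \<Rightarrow> nat" where
  "state_rank st = (let f = (\<lambda>T. card (tree_unvisited T) + card (tree_open T)) in
     case st of Expanding T T' z k \<Rightarrow> 2 * (f T + f T') | Selecting T T' k \<Rightarrow> 2 * (f T + f T') + 1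
     | Returned p \<Rightarrow> 0)"

text \<open>Each tree lacks a chain point that lies in the other. The first tree stops at an open
  \<open>y i\<close>, which the second lacks, so the second stops at an open \<open>y' j\<close>
  before reaching it. The two pieces of the chain do not overlap, hence the bound on the second
  cost.\<close>

lemma disjoint_trees_open:
  assumes y': "\<forall>i\<le>N. y' i = y (N - i)"
    and inv: "tree_inv r N y h T" "tree_inv r N y' h' T'"
    and disj: "tree_nodes T \<inter> tree_nodes T' = {}"
  obtains i j where "i + j < N" "y i \<in> tree_open T" "cost_to (y i) T \<le> chain_length y i"
    "y' j \<in> tree_open T'" "cost_to (y' j) T' \<le> chain_length y N - chain_length y i"
proof -
  have "y N \<in> tree_nodes T'" using inv(2) y' by (auto simp: tree_inv_def)
  then have "y N \<notin> tree_nodes T" using disj by auto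
  then obtain i where i: "i < N" "\<And>k. k \<le> i \<Longrightarrow> y k \<in> tree_nodes T"
    "y i \<in> tree_open T" "cost_to (y i) T \<le> chain_length y i"
    using tree_inv_open_before_gap[OF inv(1), of N] by auto
  have "y' (N - i) \<notin> tree_nodes T'" using i(1) i(2)[of i] y' disj by auto
  then obtain j where j: "j < N - i" "y' j \<in> tree_open T'" "cost_to (y' j) T' \<le> chain_length y' j"
    using tree_inv_open_before_gap[OF inv(2), of "N - i"] by auto
  have "chain_length y' j = chain_length y N - chain_length y (N - j)"
    by (rule chain_length_reverse) (use y' j in auto)
  moreover have "chain_length y i \<le> chain_length y (N - j)"
    using j by (intro chain_length_mono) simp
  ultimately show thesis using that[of i j] i j by simp
qed

text \<open>At a meeting, \<open>z\<close> and the last expanded node of the other tree cost no more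
  than the open chain points of their trees, together at most \<open>L\<close>; the meeting node
  adds at most \<open>r\<close> in each tree. In \<open>state_inv\<close>, \<open>y\<close> is the
  chain as seen from the first tree, so swapping the trees also swaps \<open>y\<close> and
  \<open>y'\<close>.\<close>

lemma bfmt_step_state_inv:
  assumes inv: "state_inv F r N L st" and step: "bfmt_step F r sample st st'"
  shows "state_inv F r N L st' \<and> state_rank st' < state_rank st"
proof -
  have "\<nexists>p. st = Returned p" using step by (auto elim: bfmt_step.cases)
  then obtain y y' h h' T T' where
    safe: "chain_safe F r N y" "chain_safe F r N y'" and L: "chain_length y N = L" and
    y': "\<forall>i\<le>N. y' i = y (N - i)" and ti: "tree_inv r N y h T" "tree_inv r N y' h' T'" and
    disj: "tree_nodes T \<inter> tree_nodes T' = {}" and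
    st: "(\<exists>z k. st = Expanding T T' z k \<and> is_arg_min (\<lambda>x. cost_to x T) (\<lambda>x. x \<in> tree_open T) z) \<or>
         (\<exists>k. st = Selecting T T' k)"
    using inv unfolding state_inv_def by (cases st) auto
  obtain i j where ij: "i + j < N" "y i \<in> tree_open T" "cost_to (y i) T \<le> chain_length y i"
    "y' j \<in> tree_open T'" "cost_to (y' j) T' \<le> L - chain_length y i"
    using disjoint_trees_open[OF y' ti disj] L by metis
  from st show ?thesis
  proof (elim disjE exE conjE)
    fix z k assume st: "st = Expanding T T' z k" and z: "is_arg_min (\<lambda>x. cost_to x T) (\<lambda>x. x \<in> tree_open T) z"
    have zo: "z \<in> tree_open T" using z by (simp add: is_arg_min_linorder)
    have fin: "finite (tree_open T)" using ti by (simp add: tree_inv_def)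
    have pos: "card (tree_open T) > 0" using zo fin by (auto simp: card_gt_0_iff)
    from step[unfolded st] show ?thesis
    proof (cases rule: bfmt_step.cases)
      case (meet T1 w)
      note E = expand_tree_inv[OF ti(1) safe(1) z disj meet(2)]
      have w: "w \<in> tree_nodes T1" "w \<in> tree_nodes T'" using E(3) by auto
      have "tree_wf T1" "cost_to w T1 \<le> cost_to z T + r" using E(1) w by (auto simp: tree_inv_def)
      moreover have "tree_wf T'" "cost_to w T' \<le> h' + r" using ti(2) w by (auto simp: tree_inv_def)
      moreover have "cost_to z T \<le> chain_length y i" using z ij by (auto simp: is_arg_min_linorder intro: order_trans)
      moreover have "h' \<le> L - chain_length y i" using ij ti(2) by (auto simp: tree_inv_def intro: order_trans)
      moreover have "polyline_length (path_to w T1 @ tl (rev (path_to w T'))) = cost_to w T1 + cost_to w T'"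
        using is_tree_path_path_to[OF \<open>tree_wf T1\<close> w(1)] is_tree_path_path_to[OF \<open>tree_wf T'\<close> w(2)]
        unfolding cost_to_def by (intro polyline_length_join) (auto simp: is_tree_path_def)
      ultimately have "polyline_length (path_to w T1 @ tl (rev (path_to w T'))) \<le> L + 2 * r" by linarith
      then show ?thesis using pos by (simp add: meet st state_inv_def state_rank_def Let_def)
    next
      case (no_meet T1)
      note E = expand_tree_inv[OF ti(1) safe(1) z disj no_meet(2)]
      have "state_inv F r N L (Selecting T1 T' k)"
        unfolding state_inv_def using E(1,2) safe L y' ti(2) by auto
      then show ?thesis using E(4) by (simp add: no_meet st state_rank_def Let_def)
    qed
  next
    fix k assume st: "st = Selecting T T' k"
    \<comment> \<open>A nonempty wavefront excludes both insertion rules, so no fresh sample is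
      drawn.\<close>
    have ne: "tree_open T' \<noteq> {}" using ij by auto
    from step[unfolded st] show ?thesis
    proof (cases rule: bfmt_step.cases)
      case (select z)
      have rev: "y i = y' (N - i)" if "i \<le> N" for i using y' that by simp
      have L': "chain_length y' N = L" using chain_length_reverse[of N y' y N] y' L by (simp add: chain_length_def)
      have "state_inv F r N L (Expanding T' T z k)"
        unfolding state_inv_def using safe L' rev ti disj select(2) by (auto simp: Int_commute)
      then show ?thesis by (simp add: select st state_rank_def Let_def)
    qed (use ne in auto)
  qed
qed

lemma tree_inv_init_tree:
  assumes "finite S" "y ` {..N} \<subseteq> S" "0 \<le> r"
  shows "tree_inv r N y 0 (init_tree S (y 0))"
proof -
  have path: "is_tree_path x (init_tree S (y 0)) p \<longleftrightarrow> x = y 0 \<and> p = [y 0]" for x p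
    by (cases p; cases "tl p") (auto simp: is_tree_path_def init_tree_def)
  then have "path_to (y 0) (init_tree S (y 0)) = [y 0]" by (simp add: path_to_def)
  then have c: "cost_to (y 0) (init_tree S (y 0)) = 0" by (simp add: cost_to_def)
  have "tree_wf (init_tree S (y 0))" unfolding tree_wf_def path by (auto simp: init_tree_def)
  then show ?thesis using assms c chain_length_nonneg[of y]
    by (auto simp: tree_inv_def init_tree_def)
qed

text \<open>The bound holds however ties are broken. Because the rank decreases with every step, the
  infinite alternative in \<open>bfmt_cost\<close> cannot occur.\<close>

lemma bfmt_cost_le_chain:
  assumes cost: "bfmt_cost F xinit xgoal r n sample c" and ne: "xinit \<noteq> xgoal"
    and y: "y 0 = xinit" "y N = xgoal" "y ` {..N} \<subseteq> {xinit, xgoal} \<union> sample ` {..<n}"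
    and safe: "chain_safe F r N y" and r: "0 \<le> r"
  shows "c \<le> ereal (chain_length y N + 2 * r)"
proof -
  define st0 where "st0 = bfmt_start xinit xgoal n sample"
  define S where "S = {xinit, xgoal} \<union> sample ` {..<n}"
  define y' where "y' = (\<lambda>i. y (N - i))"
  have finS: "finite S" by (simp add: S_def)
  have "y' ` {..N} \<subseteq> y ` {..N}" by (auto simp: y'_def)
  then have y': "y' 0 = xgoal" "y' ` {..N} \<subseteq> S" using y by (auto simp: y'_def S_def)
  have safe': "chain_safe F r N y'"
    unfolding chain_safe_def
  proof (intro conjI allI impI)
    fix i assume i: "i < N"
    then have "Suc (N - Suc i) = N - i" by simp
    moreover have "dist (y (N - Suc i)) (y (Suc (N - Suc i))) < r" using safe i by (simp add: chain_safe_def)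
    ultimately show "dist (y' i) (y' (Suc i)) < r" by (simp add: y'_def dist_commute)
  qed (use safe in \<open>auto simp: chain_safe_def y'_def\<close>)
  have t: "tree_inv r N y 0 (init_tree S xinit)" "tree_inv r N y' 0 (init_tree S xgoal)"
    using tree_inv_init_tree[OF finS _ r, of y N] tree_inv_init_tree[OF finS y'(2) r] y y' by (auto simp: S_def)
  have inv0: "state_inv F r N (chain_length y N) st0"
    unfolding state_inv_def st0_def bfmt_start_def Let_def S_def[symmetric] bfmt_state.case
    using safe safe' t ne
    by (intro exI[of _ y] exI[of _ y'] exI[of _ 0] exI[of _ "init_tree S xinit"] exI[of _ "init_tree S xgoal"])
      (auto simp: y'_def is_arg_min_def init_tree_def)
  show ?thesis
    using cost ne unfolding bfmt_cost_def st0_def[symmetric]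
  proof (simp, elim disjE exE conjE)
    fix p assume steps: "(bfmt_step F r sample)\<^sup>*\<^sup>* st0 (Returned p)" and c: "c = ereal (polyline_length p)"
    from steps have "state_inv F r N (chain_length y N) (Returned p)"
      by (induction rule: rtranclp_induct) (use inv0 bfmt_step_state_inv in blast)+
    then show ?thesis by (simp add: c state_inv_def)
  next
    fix st assume st: "st 0 = st0" "\<forall>i. bfmt_step F r sample (st i) (st (Suc i))"
    \<comment> \<open>Along an infinite run the rank would drop at each step, which is contradictory
      once \<open>i\<close> exceeds the initial rank.\<close>
    have "state_inv F r N (chain_length y N) (st i) \<and> state_rank (st i) + i \<le> state_rank st0" for i
    proof (induction i)
      case (Suc i)
      then show ?case using bfmt_step_state_inv[of F r N _ "st i" sample "st (Suc i)"] st by fastforce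
    qed (use st inv0 in auto)
    from this[of "Suc (state_rank st0)"] show ?thesis by simp
  qed
qed

section \<open>Chains along a curve\<close>

text \<open>Clearance only speaks of obstacles. The ball is connected, meets \<open>X\<close>
  because its centre is in the closure, and misses \<open>frontier X\<close>, so it cannot leave
  \<open>X\<close>.\<close>

lemma ball_subset_of_delta_interior:
  assumes "frontier X \<subseteq> Xobs" "x \<in> delta_interior \<delta> X Xobs" "0 < \<delta>"
  shows "ball x \<delta> \<subseteq> X - Xobs"
proof -
  have no_obs: "ball x \<delta> \<inter> Xobs = {}" using assms by (force simp: delta_interior_def)
  have "x \<in> closure (X - Xobs)" using assms by (simp add: delta_interior_def free_space_def)
  then have "ball x \<delta> \<inter> X \<noteq> {}"
    using assms(3) open_Int_closure_eq_empty[of "ball x \<delta>" "X - Xobs"] centre_in_ball[of x \<delta>]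
    by blast
  moreover have "ball x \<delta> \<inter> frontier X = {}" using no_obs assms(1) by auto
  ultimately have "ball x \<delta> \<subseteq> X"
    using connected_Int_frontier[of "ball x \<delta>" X] by blast
  then show ?thesis using no_obs by auto
qed

lemma arc_length_upper:
  assumes "bounded_variation \<sigma>" "sorted ts" "set ts \<subseteq> {0..1}"
  shows "polyline_length (map \<sigma> ts) \<le> arc_length \<sigma>"
  unfolding arc_length_def using assms
  by (intro cSup_upper) (auto simp: inscribed_lengths_def bounded_variation_def)

definition is_chain :: "'a::metric_space set \<Rightarrow> 'a \<Rightarrow> 'a \<Rightarrow> real \<Rightarrow> nat \<Rightarrow> (nat \<Rightarrow> 'a) \<Rightarrow> bool" where
  "is_chain P a b h N y \<longleftrightarrow> y 0 = a \<and> y N = b \<and> (\<forall>i\<le>N. y i \<in> P) \<and> (\<forall>i<N. dist (y i) (y (Suc i)) \<le> h)"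

text \<open>Walking along the curve, each time to a point at distance exactly \<open>h\<close>, uses up arc length \<open>h\<close>
  per step.\<close>

lemma chain_along_path:
  assumes "path \<sigma>" "bounded_variation \<sigma>" "0 < h"
  obtains N y where "is_chain (path_image \<sigma>) (pathstart \<sigma>) (pathfinish \<sigma>) h N y"
    "real N * h \<le> arc_length \<sigma> + h"
proof -
  define walk where "walk k t \<longleftrightarrow> t 0 = 0 \<and> (\<forall>i\<le>k. t i \<in> {0..1}) \<and>
    (\<forall>i<k. t i \<le> t (Suc i) \<and> dist (\<sigma> (t i)) (\<sigma> (t (Suc i))) = h)" for k and t :: "nat \<Rightarrow> real"
  have bound: "real k * h \<le> arc_length \<sigma>" if w: "walk k t" for k t
  proof -
    have mono: "t i \<le> t j" if "i \<le> j" "j \<le> k" for i j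
      using that
    proof (induction j rule: dec_induct)
      case (step j)
      then show ?case using w unfolding walk_def by (meson Suc_leD Suc_le_lessD order_trans)
    qed simp
    have "polyline_length (map \<sigma> (map t [0..<Suc k])) \<le> arc_length \<sigma>"
    proof (rule arc_length_upper[OF assms(2)])
      show "sorted (map t [0..<Suc k])"
        using mono by (auto simp del: upt_Suc simp: sorted_iff_nth_mono)
      show "set (map t [0..<Suc k]) \<subseteq> {0..1}" using w by (auto simp: walk_def)
    qed
    moreover have "polyline_length (map \<sigma> (map t [0..<Suc k])) = (\<Sum>i<k. h)"
      unfolding polyline_length_def using w
      by (intro sum.cong) (auto simp del: upt_Suc simp: walk_def)
    ultimately show ?thesis by simp
  qed
  have walk0: "walk 0 (\<lambda>_. 0)" by (simp add: walk_def)
  \<comment> \<open>The number of steps of a walk is bounded, so a longest walk exists.\<close>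
  have "k \<le> nat \<lfloor>arc_length \<sigma> / h\<rfloor>" if "\<exists>t. walk k t" for k
    using that bound[of k] assms(3) by (auto simp: le_nat_floor pos_le_divide_eq)
  then obtain k where k: "\<exists>t. walk k t" "\<And>l. \<exists>t. walk l t \<Longrightarrow> l \<le> k"
    using Nat.ex_has_greatest_nat[of "\<lambda>k. \<exists>t. walk k t" 0] walk0 by blast
  then obtain t where t: "walk k t" by blast
  have tk: "t k \<in> {0..1}" using t by (simp add: walk_def)
  have last: "dist (\<sigma> (t k)) (\<sigma> 1) < h"
  \<comment> \<open>Otherwise the intermediate value theorem yields a later point at distance
    exactly \<open>h\<close>, which extends the longest walk.\<close>
  proof (rule ccontr)
    assume far: "\<not> dist (\<sigma> (t k)) (\<sigma> 1) < h"
    have "continuous_on {t k..1} \<sigma>"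
      by (rule continuous_on_subset[OF assms(1)[unfolded path_def]]) (use tk in auto)
    then have cont: "continuous_on {t k..1} (\<lambda>s. dist (\<sigma> (t k)) (\<sigma> s))"
      by (intro continuous_intros)
    obtain s where s: "t k \<le> s" "s \<le> 1" "dist (\<sigma> (t k)) (\<sigma> s) = h"
      using IVT'[of "\<lambda>s. dist (\<sigma> (t k)) (\<sigma> s)" "t k" h 1, OF _ _ _ cont] far assms(3) tk
      by auto
    have "walk (Suc k) (\<lambda>i. if i \<le> k then t i else s)"
      unfolding walk_def
    proof (intro conjI allI impI)
      fix i assume "i < Suc k"
      then consider "i < k" | "i = k" by linarith
      then show "(if i \<le> k then t i else s) \<le> (if Suc i \<le> k then t (Suc i) else s)"
        "dist (\<sigma> (if i \<le> k then t i else s)) (\<sigma> (if Suc i \<le> k then t (Suc i) else s)) = h"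
        using t s by (cases; simp add: walk_def)+
    qed (use t s tk in \<open>auto simp: walk_def\<close>)
    then show False using k(2)[of "Suc k"] by auto
  qed
  show thesis
  proof (rule that)
    show "is_chain (path_image \<sigma>) (pathstart \<sigma>) (pathfinish \<sigma>) h (Suc k)
        (\<lambda>i. if i \<le> k then \<sigma> (t i) else \<sigma> 1)"
      unfolding is_chain_def
    proof (intro conjI allI impI)
      fix i assume "i < Suc k"
      then consider "i < k" | "i = k" by linarith
      then show "dist (if i \<le> k then \<sigma> (t i) else \<sigma> 1) (if Suc i \<le> k then \<sigma> (t (Suc i)) else \<sigma> 1) \<le> h"
        using t last by cases (auto simp: walk_def)
    qed (use t in \<open>auto simp: walk_def pathstart_def pathfinish_def path_image_def\<close>)
    \<comment> \<open>The extra \<open>h\<close> accounts for the final step to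
      \<open>\<sigma> 1\<close>, which is shorter than \<open>h\<close>.\<close>
    show "real (Suc k) * h \<le> arc_length \<sigma> + h" using bound[OF t] by (simp add: algebra_simps)
  qed
qed

text \<open>The curve may return to places it has visited before, so consecutive points along it need not be
  separated from later ones; a chain with the least number of steps has no such near returns.\<close>

lemma shortest_chain:
  assumes "is_chain P a b h N0 y0"
  obtains N y where "N \<le> N0" "is_chain P a b h N y"
    "\<And>i j. Suc i < j \<Longrightarrow> j \<le> N \<Longrightarrow> h < dist (y i) (y j)"
proof -
  define N where "N = (LEAST N. \<exists>y. is_chain P a b h N y)"
  have ex: "\<exists>y. is_chain P a b h N y" and le: "N \<le> N0"
    unfolding N_def using assms LeastI[of "\<lambda>N. \<exists>y. is_chain P a b h N y" N0] by (auto intro: Least_le)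
  have least: "N \<le> m" if "is_chain P a b h m y" for m y
    unfolding N_def using that by (auto intro: Least_le)
  obtain y where y: "is_chain P a b h N y" using ex by blast
  have "h < dist (y i) (y j)" if ij: "Suc i < j" "j \<le> N" for i j
  proof (rule ccontr)
    assume "\<not> h < dist (y i) (y j)"
    \<comment> \<open>Shortcut: go from \<open>y i\<close> straight to \<open>y j\<close>, omitting
      the \<open>e\<close> points in between.\<close>
    define e where "e = j - Suc i"
    define y' where "y' = (\<lambda>k. if k \<le> i then y k else y (k + e))"
    have e: "0 < e" "e \<le> N" "i + e < N" "Suc i + e = j" using ij by (auto simp: e_def)
    have "is_chain P a b h (N - e) y'"
      unfolding is_chain_def
    proof (intro conjI allI impI)
      fix k assume k: "k < N - e"
      consider "k < i" | "k = i" | "i < k" by linarith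
      then show "dist (y' k) (y' (Suc k)) \<le> h"
        using y k e \<open>\<not> h < dist (y i) (y j)\<close> by cases (auto simp: y'_def is_chain_def)
    qed (use y e in \<open>auto simp: y'_def is_chain_def\<close>)
    from least[OF this] show False using e by linarith
  qed
  then show thesis using that[OF le y] by blast
qed

section \<open>Samples in balls\<close>

text \<open>Balls with consecutive indices may overlap, but indices of equal parity are never
  consecutive. The even and the odd balls each form a disjoint family inside the union, and adding
  the two bounds gives the factor one half.\<close>

lemma measure_UN_balls_ge:
  fixes y :: "nat \<Rightarrow> 'a::euclidean_space"
  assumes "finite J" "0 \<le> s"
    and far: "\<And>i j. i \<in> J \<Longrightarrow> j \<in> J \<Longrightarrow> Suc i < j \<Longrightarrow> 2 * s \<le> dist (y i) (y j)"
  shows "real (card J) / 2 * (unit_ball_vol (real DIM('a)) * s ^ DIM('a)) \<le> measure lborel (\<Union>j\<in>J. ball (y j) s)"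
proof -
  let ?v = "unit_ball_vol (real DIM('a)) * s ^ DIM('a)"
  have v: "measure lborel (ball (y j) s) = ?v" for j using assms(2) by (simp add: content_ball)
  have v0: "0 \<le> ?v" using v[of 0] measure_nonneg[of lborel "ball (y 0) s"] by simp
  have same: "real (card I) * ?v \<le> measure lborel (\<Union>j\<in>J. ball (y j) s)"
    if I: "I \<subseteq> J" "\<And>i j. i \<in> I \<Longrightarrow> j \<in> I \<Longrightarrow> i < j \<Longrightarrow> Suc i < j" for I
  proof -
    have finI: "finite I" using I assms finite_subset by blast
    have dis: "ball (y i) s \<inter> ball (y j) s = {}" if "i \<in> I" "j \<in> I" "i < j" for i j
      using far[of i j] I that by (intro disjoint_ballI) auto
    have "disjoint_family_on (\<lambda>j. ball (y j) s) I"
      unfolding disjoint_family_on_def using dis by (metis Int_commute linorder_neqE_nat)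
    then have "measure lborel (\<Union>j\<in>I. ball (y j) s) = (\<Sum>j\<in>I. measure lborel (ball (y j) s))"
      using finI emeasure_lborel_ball_finite by (intro measure_finite_Union) (auto simp: less_top)
    moreover have "measure lborel (\<Union>j\<in>I. ball (y j) s) \<le> measure lborel (\<Union>j\<in>J. ball (y j) s)"
      using I assms(1) emeasure_lborel_ball_finite
      by (intro measure_mono_fmeasurable fmeasurable.finite_UN)
        (auto intro!: fmeasurableI simp: finI)
    ultimately show ?thesis by (simp add: v)
  qed
  have "card J = card ({j\<in>J. even j} \<union> {j\<in>J. odd j})" by (rule arg_cong[of _ _ card]) blast
  also have "\<dots> = card {j\<in>J. even j} + card {j\<in>J. odd j}"
    using assms(1) by (intro card_Un_disjoint) auto
  finally have "real (card J) = real (card {j\<in>J. even j}) + real (card {j\<in>J. odd j})" by simp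
  moreover have "real (card {j\<in>J. even j}) * ?v \<le> measure lborel (\<Union>j\<in>J. ball (y j) s)"
    by (rule same) (auto intro!: Suc_lessI)
  moreover have "real (card {j\<in>J. odd j}) * ?v \<le> measure lborel (\<Union>j\<in>J. ball (y j) s)"
    by (rule same) (auto intro!: Suc_lessI)
  ultimately show ?thesis by (simp only: distrib_right add_divide_distrib times_divide_eq_left)
qed

text \<open>One sample misses \<open>B\<close> with probability \<open>1 - q\<close>, where
  \<open>q\<close> is the relative volume of \<open>B\<close>; independence and
  \<open>1 - q \<le> exp (- q)\<close> give the bound.\<close>

lemma (in prob_space) prob_no_sample_le:
  fixes X :: "nat \<Rightarrow> 'a \<Rightarrow> 'b::euclidean_space"
  assumes indep: "indep_vars (\<lambda>_. borel) X UNIV"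
    and distr: "\<And>i. distr M borel (X i) = uniform_measure lborel F"
    and F: "0 < emeasure lborel F" "emeasure lborel F < \<infinity>"
    and B: "B \<in> sets borel" "B \<subseteq> F"
  shows "{\<omega> \<in> space M. \<forall>i<n. X i \<omega> \<notin> B} \<in> events"
    and "prob {\<omega> \<in> space M. \<forall>i<n. X i \<omega> \<notin> B} \<le> exp (- (real n * (measure lborel B / measure lborel F)))"
proof -
  have X: "random_variable borel (X i)" for i using indep by (simp add: indep_vars_def)
  show "{\<omega> \<in> space M. \<forall>i<n. X i \<omega> \<notin> B} \<in> events"
    using X B(1) by measurable
  let ?q = "measure lborel B / measure lborel F"
  have pX: "prob (X i -` (- B) \<inter> space M) = 1 - ?q" for i
  proof -
    have "prob (X i -` B \<inter> space M) = measure (uniform_measure lborel F) B"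
      using measure_distr[OF X B(1), of i] distr by simp
    also have "\<dots> = ?q"
      using F B by (subst measure_uniform_measure) (auto simp: Int_absorb1)
    finally have "prob (X i -` B \<inter> space M) = ?q" .
    moreover have "X i -` (- B) \<inter> space M = space M - (X i -` B \<inter> space M)" by auto
    ultimately show ?thesis using X B by (simp add: prob_compl measurable_sets)
  qed
  show "prob {\<omega> \<in> space M. \<forall>i<n. X i \<omega> \<notin> B} \<le> exp (- (real n * ?q))"
  \<comment> \<open>An intersection over no indices would not be confined to
    \<open>space M\<close>.\<close>
  proof (cases "n = 0")
    case False
    have "{\<omega> \<in> space M. \<forall>i<n. X i \<omega> \<notin> B} = (\<Inter>i<n. X i -` (- B) \<inter> space M)" using False by auto
    also have "prob \<dots> = (\<Prod>i<n. prob (X i -` (- B) \<inter> space M))"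
      using False B by (intro indep_varsD[OF indep]) auto
    also have "\<dots> = (1 - ?q) ^ n" by (simp add: pX)
    also have "\<dots> \<le> exp (- ?q) ^ n"
      using pX[of 0] measure_nonneg[of M "X 0 -` (- B) \<inter> space M"] exp_ge_add_one_self[of "- ?q"]
      by (intro power_mono) auto
    also have "\<dots> = exp (- (real n * ?q))" by (simp flip: exp_of_nat_mult)
    finally show ?thesis .
  qed (simp add: prob_le_1)
qed

text \<open>Bounds an event that may be nonmeasurable through a measurable one containing
  it.\<close>

lemma (in prob_space) outer_prob_le_prob:
  assumes "A \<subseteq> B" "B \<in> events"
  shows "outer_prob M A \<le> prob B"
proof -
  have "outer_measure_of M A \<le> emeasure M B"
    using assms outer_measure_of_mono by (metis outer_measure_of_eq)
  then show ?thesis unfolding outer_prob_def measure_def by (intro enn2real_mono) (auto simp: less_top[symmetric])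
qed

text \<open>Each inner waypoint moves to a sample, by at most \<open>\<beta> * r\<close>, or by less
  than \<open>r / 4\<close> where the small ball is empty. The displacements total at most
  \<open>5 / 4 * \<beta> * r * N\<close>, and each affects two steps, which gives
  \<open>10 * \<beta>\<close> relative to \<open>N * r / 4\<close>.\<close>

lemma chain_through_samples:
  fixes y :: "nat \<Rightarrow> 'a::metric_space"
  assumes y: "is_chain P a b (r / 4) N y" and r: "0 < r" and \<beta>: "0 \<le> \<beta>" "\<beta> \<le> 1 / 4"
    and hit: "\<And>i. 0 < i \<Longrightarrow> i < N \<Longrightarrow> ball (y i) (r / 4) \<inter> W \<noteq> {}"
    and few: "real (card {i \<in> {0<..<N}. ball (y i) (\<beta> * r) \<inter> W = {}}) \<le> \<beta> * real N"
  obtains x where "x 0 = a" "x N = b" "x ` {..N} \<subseteq> {a, b} \<union> W"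
    "\<And>i. i \<le> N \<Longrightarrow> dist (y i) (x i) < r / 4"
    "chain_length x N \<le> real N * (r / 4) * (1 + 10 * \<beta>)"
proof -
  define bad where "bad = {i \<in> {0<..<N}. ball (y i) (\<beta> * r) \<inter> W = {}}"
  have "\<exists>w. w \<in> W \<and> dist (y i) w < r / 4 \<and> (i \<notin> bad \<longrightarrow> dist (y i) w \<le> \<beta> * r)" if i: "0 < i" "i < N" for i
  proof (cases "i \<in> bad")
    case True
    then show ?thesis using hit[OF i] by auto
  next
    case False
    then obtain w where "w \<in> W" "dist (y i) w < \<beta> * r" using i by (auto simp: bad_def)
    moreover have "\<beta> * r \<le> r / 4" using \<beta> r mult_right_mono[of \<beta> "1/4" r] by simp
    ultimately show ?thesis by (intro exI[of _ w]) auto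
  qed
  then obtain w where w: "\<And>i. 0 < i \<Longrightarrow> i < N \<Longrightarrow>
      w i \<in> W \<and> dist (y i) (w i) < r / 4 \<and> (i \<notin> bad \<longrightarrow> dist (y i) (w i) \<le> \<beta> * r)" by metis
  define x where "x = (\<lambda>i. if 0 < i \<and> i < N then w i else y i)"
  define e where "e = (\<lambda>i. dist (y i) (x i))"
  have e0: "e i = 0" if "i = 0 \<or> N \<le> i" for i using that by (auto simp: e_def x_def)
  have e_le: "e i \<le> \<beta> * r + (if i \<in> bad then r / 4 else 0)" for i
    using w[of i] \<beta> r by (cases "0 < i \<and> i < N") (auto simp: e_def x_def less_imp_le add_increasing)
  have finb: "bad \<subseteq> {..<N}" by (auto simp: bad_def)
  have "(\<Sum>i<N. e i) \<le> (\<Sum>i<N. \<beta> * r + (if i \<in> bad then r / 4 else 0))" by (intro sum_mono e_le)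
  also have "\<dots> = real N * (\<beta> * r) + real (card bad) * (r / 4)"
    using finb by (simp add: sum.distrib sum.If_cases Int_absorb1)
  also have "\<dots> \<le> real N * (\<beta> * r) + (\<beta> * real N) * (r / 4)"
    using few r unfolding bad_def[symmetric] by (intro add_left_mono mult_right_mono) auto
  finally have sum_e: "(\<Sum>i<N. e i) \<le> real N * (\<beta> * r) + (\<beta> * real N) * (r / 4)" .
  \<comment> \<open>The two end points do not move, so shifting the index leaves the sum
    unchanged.\<close>
  have "(\<Sum>i<N. e (Suc i)) = (\<Sum>i<N. e i)"
    using sum.lessThan_Suc_shift[of e N] e0 by simp
  moreover have "chain_length x N \<le> (\<Sum>i<N. r / 4 + e i + e (Suc i))"
    unfolding chain_length_def
  proof (rule sum_mono)
    fix i assume "i \<in> {..<N}"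
    then have "dist (y i) (y (Suc i)) \<le> r / 4" using y by (simp add: is_chain_def)
    then show "dist (x i) (x (Suc i)) \<le> r / 4 + e i + e (Suc i)"
      using dist_triangle[of "x i" "x (Suc i)" "y i"] dist_triangle[of "y i" "x (Suc i)" "y (Suc i)"]
      unfolding e_def by (simp add: dist_commute)
  qed
  ultimately have "chain_length x N \<le> real N * (r / 4) + 2 * (\<Sum>i<N. e i)"
    by (simp add: sum.distrib)
  with sum_e have len: "chain_length x N \<le> real N * (r / 4) * (1 + 10 * \<beta>)"
    by (simp add: algebra_simps)
  show thesis
  proof (rule that[OF _ _ _ _ len])
    show "x 0 = a" "x N = b" using y by (auto simp: x_def is_chain_def)
    show "x ` {..N} \<subseteq> {a, b} \<union> W"
    proof
      fix v assume "v \<in> x ` {..N}"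
      then obtain i where i: "i \<le> N" "v = x i" by auto
      show "v \<in> {a, b} \<union> W"
      proof (cases "0 < i \<and> i < N")
        case True
        then show ?thesis using i w[of i] by (simp add: x_def)
      next
        case False
        then have "i = 0 \<or> i = N" using i by auto
        then show ?thesis using i y by (auto simp: x_def is_chain_def)
      qed
    qed
    show "dist (y i) (x i) < r / 4" if "i \<le> N" for i
      using w[of i] r by (auto simp: x_def)
  qed
qed

text \<open>\<open>q\<close> is the probability that a given sample falls into the ball of radius
  \<open>r / 4\<close> around a waypoint. On \<open>E1\<close> some such ball is empty; on
  \<open>E2\<close> some set \<open>J\<close> of at least \<open>\<beta> * N\<close> waypoints has
  only empty small balls. There are at most \<open>2 ^ N\<close> such sets, and
  \<open>(4 * \<beta>) ^ DIM('b)\<close> is the volume ratio of small to large balls.\<close>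

lemma (in prob_space) samples_hit_balls:
  fixes X :: "nat \<Rightarrow> 'a \<Rightarrow> 'b::euclidean_space" and y :: "nat \<Rightarrow> 'b"
  assumes indep: "indep_vars (\<lambda>_. borel) X UNIV"
    and distr: "\<And>i. distr M borel (X i) = uniform_measure lborel F"
    and F: "0 < emeasure lborel F" "emeasure lborel F < \<infinity>"
    and r: "0 < r" and \<beta>: "0 < \<beta>" "\<beta> \<le> 1 / 8"
    and inF: "\<And>i. i \<le> N \<Longrightarrow> ball (y i) (r / 4) \<subseteq> F"
    and far: "\<And>i j. Suc i < j \<Longrightarrow> j \<le> N \<Longrightarrow> r / 4 < dist (y i) (y j)"
    and q: "q = unit_ball_vol (real DIM('b)) * (r / 4) ^ DIM('b) / measure lborel F"
  obtains E where "E \<in> events"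
    "prob E \<le> real N * exp (- (real n * q))
       + 2 ^ N * exp (- (real n * (\<beta> * real N / 2 * ((4 * \<beta>) ^ DIM('b) * q))))"
    "\<forall>\<omega>\<in>space M - E. \<forall>i\<in>{0<..<N}. ball (y i) (r / 4) \<inter> (\<lambda>i. X i \<omega>) ` {..<n} \<noteq> {}"
    "\<forall>\<omega>\<in>space M - E.
       real (card {i \<in> {0<..<N}. ball (y i) (\<beta> * r) \<inter> (\<lambda>i. X i \<omega>) ` {..<n} = {}}) \<le> \<beta> * real N"
proof -
  define miss where "miss B = {\<omega> \<in> space M. \<forall>i<n. X i \<omega> \<notin> B}" for B
  define E1 where "E1 = (\<Union>i\<in>{0<..<N}. miss (ball (y i) (r / 4)))"
  define \<J> where "\<J> = {J. J \<subseteq> {0<..<N} \<and> \<beta> * real N \<le> real (card J)}"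
  define U where "U J = (\<Union>i\<in>J. ball (y i) (\<beta> * r))" for J
  define E2 where "E2 = (\<Union>J\<in>\<J>. miss (U J))"
  have \<mu>: "0 < measure lborel F" using F by (simp add: measure_def enn2real_positive_iff)
  have q0: "0 \<le> q" using r \<mu> by (simp add: q)
  note miss = prob_no_sample_le[OF indep distr F, where n = n, folded miss_def]
  \<comment> \<open>The second bound rests on \<open>\<beta> \<le> 1 / 8\<close> and makes the small
    balls around non-neighbouring waypoints disjoint.\<close>
  have \<beta>r: "\<beta> * r \<le> r / 4" "2 * (\<beta> * r) \<le> r / 4" "0 \<le> \<beta> * r"
    using \<beta> r mult_right_mono[of \<beta> "1/8" r] by auto
  have finJ: "finite \<J>" and cardJ: "card \<J> \<le> 2 ^ N"
  proof -
    have sub: "\<J> \<subseteq> Pow {0<..<N}" by (auto simp: \<J>_def)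
    then show "finite \<J>" by (rule finite_subset) simp
    have "card \<J> \<le> card (Pow {0<..<N})" using sub by (intro card_mono) auto
    also have "\<dots> \<le> 2 ^ N" by (simp add: card_Pow)
    finally show "card \<J> \<le> 2 ^ N" .
  qed
  have U: "U J \<in> sets borel" "U J \<subseteq> F" if "J \<in> \<J>" for J
  proof -
    show "U J \<in> sets borel" unfolding U_def by (intro borel_open open_UN) auto
    have "ball (y i) (\<beta> * r) \<subseteq> F" if "i \<in> J" for i
      using inF[of i] subset_ball[OF \<beta>r(1), of "y i"] that \<open>J \<in> \<J>\<close> by (fastforce simp: \<J>_def)
    then show "U J \<subseteq> F" by (auto simp: U_def)
  qed
  have E1: "E1 \<in> events" unfolding E1_def
    using inF by (intro sets.finite_UN miss) auto
  have E2: "E2 \<in> events" unfolding E2_def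
    using U finJ by (intro sets.finite_UN miss) auto
  have "prob E1 \<le> (\<Sum>i\<in>{0<..<N}. prob (miss (ball (y i) (r / 4))))"
    unfolding E1_def using inF by (intro measure_UNION_le miss) auto
  also have "\<dots> \<le> (\<Sum>i\<in>{0<..<N}. exp (- (real n * q)))"
  proof (rule sum_mono)
    fix i assume "i \<in> {0<..<N}"
    then have "ball (y i) (r / 4) \<subseteq> F" using inF by simp
    from miss(2)[OF _ this] show "prob (miss (ball (y i) (r / 4))) \<le> exp (- (real n * q))"
      using r by (simp add: content_ball q)
  qed
  also have "\<dots> \<le> real N * exp (- (real n * q))" by (simp add: mult_right_mono)
  finally have p1: "prob E1 \<le> real N * exp (- (real n * q))" .
  let ?e = "exp (- (real n * (\<beta> * real N / 2 * ((4 * \<beta>) ^ DIM('b) * q))))"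
  have "prob E2 \<le> (\<Sum>J\<in>\<J>. prob (miss (U J)))"
    unfolding E2_def using U finJ by (intro measure_UNION_le miss) auto
  also have "\<dots> \<le> (\<Sum>J\<in>\<J>. ?e)"
  proof (rule sum_mono)
    fix J assume J: "J \<in> \<J>"
    let ?v = "unit_ball_vol (real DIM('b)) * (\<beta> * r) ^ DIM('b)"
    have v: "?v / measure lborel F = (4 * \<beta>) ^ DIM('b) * q"
      by (simp add: q power_divide power_mult_distrib)
    have "real (card J) / 2 * ?v \<le> measure lborel (U J)"
      unfolding U_def
    proof (rule measure_UN_balls_ge)
      show "finite J" using J finite_subset by (auto simp: \<J>_def)
      fix i j assume "i \<in> J" "j \<in> J" "Suc i < j"
      then have "r / 4 < dist (y i) (y j)" using J by (intro far) (auto simp: \<J>_def)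
      then show "2 * (\<beta> * r) \<le> dist (y i) (y j)" using \<beta>r by linarith
    qed (use \<beta>r in auto)
    from divide_right_mono[OF this less_imp_le[OF \<mu>]]
    have "real (card J) / 2 * (?v / measure lborel F) \<le> measure lborel (U J) / measure lborel F"
      by (simp only: times_divide_eq_right)
    then have vol: "real (card J) / 2 * ((4 * \<beta>) ^ DIM('b) * q) \<le> measure lborel (U J) / measure lborel F"
      unfolding v .
    have "\<beta> * real N / 2 * ((4 * \<beta>) ^ DIM('b) * q) \<le> real (card J) / 2 * ((4 * \<beta>) ^ DIM('b) * q)"
      using J \<beta> q0 by (intro mult_right_mono) (auto simp: \<J>_def)
    from order_trans[OF this vol] have "real n * (\<beta> * real N / 2 * ((4 * \<beta>) ^ DIM('b) * q)) \<le>
        real n * (measure lborel (U J) / measure lborel F)"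
      by (intro mult_left_mono) auto
    then have "exp (- (real n * (measure lborel (U J) / measure lborel F))) \<le> ?e" by simp
    with miss(2)[OF U[OF J]] show "prob (miss (U J)) \<le> ?e" by (rule order_trans)
  qed
  also have "\<dots> \<le> 2 ^ N * ?e"
    using of_nat_mono[OF cardJ, where 'a = real] by (simp add: mult_right_mono)
  finally have p2: "prob E2 \<le> 2 ^ N * ?e" .
  show thesis
  proof (rule that[of "E1 \<union> E2"])
    show "E1 \<union> E2 \<in> events" using E1 E2 by auto
    show "prob (E1 \<union> E2) \<le> real N * exp (- (real n * q)) + 2 ^ N * ?e"
      using measure_Un_le[OF E1 E2] p1 p2 by linarith
    show "\<forall>\<omega>\<in>space M - (E1 \<union> E2). \<forall>i\<in>{0<..<N}. ball (y i) (r / 4) \<inter> (\<lambda>i. X i \<omega>) ` {..<n} \<noteq> {}"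
      by (auto simp: E1_def miss_def simp del: mem_ball)
    show "\<forall>\<omega>\<in>space M - (E1 \<union> E2).
       real (card {i \<in> {0<..<N}. ball (y i) (\<beta> * r) \<inter> (\<lambda>i. X i \<omega>) ` {..<n} = {}}) \<le> \<beta> * real N"
    proof
      fix \<omega> assume \<omega>: "\<omega> \<in> space M - (E1 \<union> E2)"
      let ?J = "{i \<in> {0<..<N}. ball (y i) (\<beta> * r) \<inter> (\<lambda>i. X i \<omega>) ` {..<n} = {}}"
      \<comment> \<open>The set of waypoints with empty small balls is itself a candidate for
        \<open>J\<close>, so outside \<open>E2\<close> it cannot be large.\<close>
      have "\<omega> \<in> miss (U ?J)" using \<omega> by (auto simp: miss_def U_def)
      then have "?J \<notin> \<J>" using \<omega> by (auto simp: E2_def)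
      then have "\<not> \<beta> * real N \<le> real (card ?J)" unfolding \<J>_def by blast
      then show "real (card ?J) \<le> \<beta> * real N" by linarith
    qed
  qed
qed

text \<open>Joins the deterministic bound \<open>bfmt_cost_le_chain\<close> to the exceptional event
  of \<open>samples_hit_balls\<close>. Both bounds on \<open>N\<close> are exported for the rate:
  the upper one controls the first term, the lower one makes the second negligible.\<close>

lemma (in prob_space) outer_prob_bfmt_cost_le:
  fixes S Xobs Xfree :: "'b::euclidean_space set" and X :: "nat \<Rightarrow> 'a \<Rightarrow> 'b"
  assumes Xfree: "Xfree = free_space S Xobs" and front: "frontier S \<subseteq> Xobs"
    and F: "0 < emeasure lborel Xfree" "emeasure lborel Xfree < \<infinity>"
    and "feasible_path S Xobs xinit xgoal \<sigma>" and clear: "strong_clearance \<delta> S Xobs \<sigma>"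
    and indep: "indep_vars (\<lambda>_. borel) X UNIV"
    and distr: "\<And>i. distr M borel (X i) = uniform_measure lborel Xfree"
    and cost: "\<And>\<omega>. \<omega> \<in> space M \<Longrightarrow> bfmt_cost Xfree xinit xgoal r n (\<lambda>i. X i \<omega>) (c \<omega>)"
    and ne: "xinit \<noteq> xgoal"
    and r: "0 < r" "2 * r \<le> \<delta>" "6 * r \<le> \<epsilon> * arc_length \<sigma>"
    and \<beta>: "0 < \<beta>" "\<beta> \<le> 1 / 8" "20 * \<beta> \<le> \<epsilon>"
    and q: "q = unit_ball_vol (real DIM('b)) * (r / 4) ^ DIM('b) / measure lborel Xfree"
  obtains N where "4 * dist xinit xgoal \<le> real N * r" "real N * r \<le> 4 * arc_length \<sigma> + r"
    "outer_prob M {\<omega> \<in> space M. c \<omega> > ereal ((1 + \<epsilon>) * arc_length \<sigma>)} \<le>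
       real N * exp (- (real n * q))
       + 2 ^ N * exp (- (real n * (\<beta> * real N / 2 * ((4 * \<beta>) ^ DIM('b) * q))))"
proof -
  let ?L = "arc_length \<sigma>"
  have path: "path \<sigma>" "bounded_variation \<sigma>" "pathstart \<sigma> = xinit" "pathfinish \<sigma> = xgoal"
    using assms by (auto simp: feasible_path_def)
  obtain N0 y0 where y0: "is_chain (path_image \<sigma>) xinit xgoal (r / 4) N0 y0" "real N0 * (r / 4) \<le> ?L + r / 4"
    using chain_along_path[OF path(1,2), of "r / 4"] r path by auto
  obtain N y where N: "N \<le> N0" and y: "is_chain (path_image \<sigma>) xinit xgoal (r / 4) N y"
    and far: "\<And>i j. Suc i < j \<Longrightarrow> j \<le> N \<Longrightarrow> r / 4 < dist (y i) (y j)"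
    using shortest_chain[OF y0(1)] by metis
  have NL: "real N * (r / 4) \<le> ?L + r / 4"
  proof -
    have "real N * (r / 4) \<le> real N0 * (r / 4)" using N r by (intro mult_right_mono) auto
    then show ?thesis using y0(2) by linarith
  qed
  have "dist xinit xgoal \<le> chain_length y N"
    using dist_le_chain_length[of 0 N y] y by (simp add: is_chain_def chain_length_def)
  also have "\<dots> \<le> (\<Sum>i<N. r / 4)" unfolding chain_length_def
    using y by (intro sum_mono) (simp add: is_chain_def)
  finally have lower: "4 * dist xinit xgoal \<le> real N * r" by simp
  \<comment> \<open>Radius \<open>2 * r\<close> leaves room for a sample within \<open>r / 4\<close>
    of a waypoint and a parent within \<open>r\<close> of that sample.\<close>
  have clear_ball: "ball (y i) (2 * r) \<subseteq> Xfree" if "i \<le> N" for i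
  proof -
    have "y i \<in> delta_interior \<delta> S Xobs" using y clear that by (auto simp: is_chain_def strong_clearance_def)
    then have "ball (y i) \<delta> \<subseteq> S - Xobs" using ball_subset_of_delta_interior[OF front] r by auto
    then show ?thesis using subset_ball[OF r(2), of "y i"] closure_subset[of "S - Xobs"]
      by (auto simp: Xfree free_space_def)
  qed
  have inF: "ball (y i) (r / 4) \<subseteq> Xfree" if "i \<le> N" for i
    using clear_ball[OF that] subset_ball[of "r / 4" "2 * r" "y i"] r by auto
  obtain E where E: "E \<in> events"
    "prob E \<le> real N * exp (- (real n * q))
       + 2 ^ N * exp (- (real n * (\<beta> * real N / 2 * ((4 * \<beta>) ^ DIM('b) * q))))"
    "\<forall>\<omega>\<in>space M - E. \<forall>i\<in>{0<..<N}. ball (y i) (r / 4) \<inter> (\<lambda>i. X i \<omega>) ` {..<n} \<noteq> {}"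
    "\<forall>\<omega>\<in>space M - E.
       real (card {i \<in> {0<..<N}. ball (y i) (\<beta> * r) \<inter> (\<lambda>i. X i \<omega>) ` {..<n} = {}}) \<le> \<beta> * real N"
    by (rule samples_hit_balls[OF indep distr F r(1) \<beta>(1,2) inF far q, where n = n])
  have good: "c \<omega> \<le> ereal ((1 + \<epsilon>) * ?L)" if \<omega>: "\<omega> \<in> space M - E" for \<omega>
  proof -
    let ?W = "(\<lambda>i. X i \<omega>) ` {..<n}"
    obtain x where x: "x 0 = xinit" "x N = xgoal" "x ` {..N} \<subseteq> {xinit, xgoal} \<union> ?W"
      "\<And>i. i \<le> N \<Longrightarrow> dist (y i) (x i) < r / 4"
      "chain_length x N \<le> real N * (r / 4) * (1 + 10 * \<beta>)"
      using chain_through_samples[OF y r(1), where \<beta> = \<beta> and W = ?W] E(3,4) \<omega> \<beta>(1,2) by auto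
    have safe: "chain_safe Xfree r N x"
      unfolding chain_safe_def
    proof (intro conjI allI impI)
      fix i assume i: "i < N"
      \<comment> \<open>Two displacements and one waypoint step, each at most \<open>r / 4\<close>,
        add up to less than \<open>r\<close>.\<close>
      have "dist (y i) (y (Suc i)) \<le> r / 4" using y i by (simp add: is_chain_def)
      then show "dist (x i) (x (Suc i)) < r"
        using x(4)[of i] x(4)[of "Suc i"] i r dist_triangle[of "x i" "x (Suc i)" "y i"]
          dist_triangle[of "y i" "x (Suc i)" "y (Suc i)"] by (simp add: dist_commute)
    next
      fix i v assume i: "i \<le> N" and v: "dist v (x i) < r"
      have "v \<in> ball (y i) (2 * r)" "x i \<in> ball (y i) (2 * r)"
        using x(4)[OF i] v r dist_triangle[of "y i" v "x i"] by (auto simp: dist_commute)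
      then have "closed_segment v (x i) \<subseteq> ball (y i) (2 * r)"
        by (intro closed_segment_subset) auto
      then show "collision_free Xfree v (x i)" using clear_ball[OF i] by (auto simp: collision_free_def)
    qed
    have "c \<omega> \<le> ereal (chain_length x N + 2 * r)"
      using bfmt_cost_le_chain[OF cost ne x(1,2,3) safe] \<omega> r by auto
    also have "chain_length x N + 2 * r \<le> (1 + \<epsilon>) * ?L"
    proof -
      \<comment> \<open>Half of \<open>\<epsilon> * ?L\<close> pays for
        \<open>10 * \<beta> * ?L\<close>, the other half for the terms in \<open>r\<close>, which
        total at most \<open>3 * r\<close>.\<close>
      have L: "0 < \<epsilon> * ?L" using r by linarith
      have "0 < ?L" using L \<beta> by (simp add: zero_less_mult_iff)
      have "chain_length x N \<le> (?L + r / 4) * (1 + 10 * \<beta>)"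
        using x(5) mult_right_mono[OF NL, of "1 + 10 * \<beta>"] \<beta>(1) by linarith
      also have "\<dots> = ?L + 10 * (\<beta> * ?L) + r / 4 * (1 + 10 * \<beta>)" by (simp add: algebra_simps)
      finally have "chain_length x N \<le> ?L + 10 * (\<beta> * ?L) + r / 4 * (1 + 10 * \<beta>)" .
      moreover have "r / 4 * (1 + 10 * \<beta>) \<le> r / 4 * 4" using r \<beta> by (intro mult_left_mono) auto
      moreover have "20 * (\<beta> * ?L) \<le> \<epsilon> * ?L" using mult_right_mono[OF \<beta>(3), of ?L] \<open>0 < ?L\<close> by simp
      ultimately have "chain_length x N + 2 * r \<le> ?L + \<epsilon> * ?L" using r(1,3) by linarith
      then show ?thesis by (simp add: algebra_simps)
    qed
    finally show ?thesis by simp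
  qed
  have "{\<omega> \<in> space M. c \<omega> > ereal ((1 + \<epsilon>) * ?L)} \<subseteq> E"
    using good by (force simp: not_le[symmetric])
  then have "outer_prob M {\<omega> \<in> space M. c \<omega> > ereal ((1 + \<epsilon>) * ?L)} \<le> prob E"
    using E(1) by (rule outer_prob_le_prob)
  then show thesis using that[OF lower _ order_trans[OF _ E(2)]] NL by simp
qed

section \<open>Asymptotics\<close>

lemma tendsto_log_ratio_powr:
  fixes d K :: real
  assumes "0 < d"
  shows "(\<lambda>n. K * (ln (real n) / real n) powr (1 / d)) \<longlonglongrightarrow> 0"
proof -
  have "(\<lambda>n. (ln (real n) / real n) powr (1 / d)) \<longlonglongrightarrow> 0"
  proof (rule tendsto_zero_powrI[OF lim_ln_over_n tendsto_const])
    show "eventually (\<lambda>n. 0 \<le> ln (real n) / real n) sequentially"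
      using eventually_ge_at_top[of 1] by eventually_elim auto
  qed (use assms in auto)
  then show ?thesis using tendsto_mult_left[of _ 0 sequentially K] by simp
qed

text \<open>Since \<open>N\<close> is at most of order \<open>1 / r n\<close>, the first term has
  the claimed rate. Since \<open>N\<close> is also at least \<open>D / r n\<close>, which tends to
  infinity, the second term, equal to \<open>(2 * n powr (- \<kappa>)) ^ N\<close>, is eventually at
  most \<open>n powr (- a)\<close> with \<open>a = (1 + \<eta>) / d\<close>.\<close>

lemma bfmt_failure_bigo:
  fixes p r :: "nat \<Rightarrow> real"
  assumes pos: "0 < d" "0 < K" "0 < \<kappa>" "0 < D" "0 \<le> A" "0 \<le> \<eta>"
    and r: "\<And>n. r n = K * (ln (real n) / real n) powr (1 / d)"
    and p0: "\<And>n. 0 \<le> p n"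
    and p: "eventually (\<lambda>n. \<exists>N. D \<le> real N * r n \<and> real N * r n \<le> A + r n \<and>
        p n \<le> real N * real n powr (- ((1 + \<eta>) / d)) + 2 ^ N * real n powr (- \<kappa> * real N)) sequentially"
  shows "p \<in> O(\<lambda>n. real n powr (- \<eta> / d) * ln (real n) powr (- 1 / d))"
proof -
  define a where "a = (1 + \<eta>) / d"
  have a: "0 < a" using pos by (simp add: a_def)
  have lim: "r \<longlonglongrightarrow> 0"
    unfolding r[abs_def] by (rule tendsto_log_ratio_powr[OF pos(1)])
  have "eventually (\<lambda>n. r n < 1) sequentially" by (rule order_tendstoD[OF lim]) simp
  \<comment> \<open>This threshold forces \<open>N \<ge> 2 * a / \<kappa>\<close>.\<close>
  moreover have "eventually (\<lambda>n. r n < D * \<kappa> / (2 * a)) sequentially"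
    by (rule order_tendstoD[OF lim]) (use pos a in auto)
  \<comment> \<open>Half of the exponent \<open>\<kappa>\<close> is spent on absorbing the factor
    2.\<close>
  moreover have "eventually (\<lambda>n. 2 \<le> real n powr (\<kappa> / 2)) sequentially"
    using eventually_ge_at_top[of "nat \<lceil>2 powr (2 / \<kappa>)\<rceil>"]
  proof eventually_elim
    case (elim n)
    then have "2 powr (2 / \<kappa>) \<le> real n" by linarith
    then have "(2 powr (2 / \<kappa>)) powr (\<kappa> / 2) \<le> real n powr (\<kappa> / 2)"
      using pos by (intro powr_mono2) auto
    then show ?case using pos by (simp add: powr_powr)
  qed
  moreover have "eventually (\<lambda>n. 3 \<le> n) sequentially" by (rule eventually_ge_at_top)
  ultimately have "eventually (\<lambda>n. norm (p n) \<le>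
      (A + 2) / K * norm (real n powr (- \<eta> / d) * ln (real n) powr (- 1 / d))) sequentially"
    using p
  proof eventually_elim
    case (elim n)
    then obtain N where N: "D \<le> real N * r n" "real N * r n \<le> A + r n"
      "p n \<le> real N * real n powr (- ((1 + \<eta>) / d)) + 2 ^ N * real n powr (- \<kappa> * real N)" by blast
    have n: "0 < ln (real n)" "1 < real n" using elim by auto
    have rn: "0 < r n" using n pos by (simp add: r)
    have "2 * a / \<kappa> * r n \<le> D" using elim(2) a pos by (simp add: field_simps)
    then have "2 * a / \<kappa> * r n \<le> real N * r n" using N by linarith
    then have Na: "a \<le> \<kappa> / 2 * real N" using rn pos by (simp add: field_simps)
    have "2 * real n powr (- \<kappa>) \<le> real n powr (\<kappa> / 2) * real n powr (- \<kappa>)"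
      using elim(3) by (intro mult_right_mono) auto
    also have "\<dots> = real n powr (- (\<kappa> / 2))" by (simp flip: powr_add)
    finally have half: "2 * real n powr (- \<kappa>) \<le> real n powr (- (\<kappa> / 2))" .
    have "2 ^ N * real n powr (- \<kappa> * real N) = (2 * real n powr (- \<kappa>)) ^ N"
      using n by (simp add: power_mult_distrib powr_power mult.commute)
    also have "\<dots> \<le> (real n powr (- (\<kappa> / 2))) ^ N" by (rule power_mono[OF half]) simp
    also have "\<dots> = real n powr (- (\<kappa> / 2 * real N))" using n by (simp add: powr_power mult.commute)
    also have "\<dots> \<le> real n powr (- a)" using Na n by (intro powr_mono) auto
    finally have "p n \<le> (real N + 1) * real n powr (- a)"
      using N(3) by (simp add: a_def algebra_simps)
    also have "real N + 1 \<le> (A + 2) / r n" using N(2) elim(1) rn by (simp add: field_simps)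
    also have "(A + 2) / r n * real n powr (- a) =
        (A + 2) / K * (real n powr (- \<eta> / d) * ln (real n) powr (- 1 / d))"
    proof -
      \<comment> \<open>The factor \<open>n powr (1 / d)\<close> of \<open>1 / r n\<close> cancels
        the summand \<open>1 / d\<close> of \<open>a\<close>, leaving the exponent
        \<open>- \<eta> / d\<close>.\<close>
      have "real n powr (1 / d) * real n powr (- a) = real n powr (- \<eta> / d)"
        using n by (simp add: a_def add_divide_distrib flip: powr_add)
      moreover have "1 / r n = 1 / K * (ln (real n) powr (- 1 / d) * real n powr (1 / d))"
        using n pos by (simp add: r powr_divide powr_minus divide_simps)
      ultimately show ?thesis by (metis (no_types, opaque_lifting) mult.assoc mult.commute times_divide_eq_right mult_1_right)
    qed
    finally show ?case using p0[of n] n by (simp add: abs_mult)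
  qed
  then show ?thesis by (rule bigoI)
qed

theorem lemma1:
  fixes X Xobs Xfree :: "'a::euclidean_space set"
    and xinit xgoal :: 'a
    and \<sigma> :: "real \<Rightarrow> 'a"
    and \<delta> \<eta> \<epsilon> :: real
    and M :: "'w measure"
    and sample :: "nat \<Rightarrow> nat \<Rightarrow> 'w \<Rightarrow> 'a"
    and c :: "nat \<Rightarrow> 'w \<Rightarrow> ereal"
  assumes "Xfree = free_space X Xobs"
    and "open (X - Xobs)" and "frontier X \<subseteq> Xobs"
    and "0 < emeasure lborel Xfree" and "emeasure lborel Xfree < \<infinity>"
    and "\<delta> > 0"
    and "feasible_path X Xobs xinit xgoal \<sigma>" and "strong_clearance \<delta> X Xobs \<sigma>"
    and "\<eta> \<ge> 0"
    and "prob_space M"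
    and "\<And>n. prob_space.indep_vars M (\<lambda>_. borel) (sample n) UNIV"
    and "\<And>n i. distr M borel (sample n i) = uniform_measure lborel Xfree"
    and "\<And>n \<omega>. \<omega> \<in> space M \<Longrightarrow>
           bfmt_cost Xfree xinit xgoal (bfmt_radius Xfree \<eta> n) n (\<lambda>i. sample n i \<omega>) (c n \<omega>)"
    and "\<epsilon> > 0"
  shows "(\<lambda>n. outer_prob M {\<omega> \<in> space M. c n \<omega> > ereal ((1 + \<epsilon>) * arc_length \<sigma>)})
           \<in> O(\<lambda>n. real n powr (- \<eta> / real DIM('a)) * ln (real n) powr (- 1 / real DIM('a)))"
proof -
  interpret prob_space M by fact
  let ?L = "arc_length \<sigma>" and ?d = "real DIM('a)"
  let ?p = "\<lambda>n. outer_prob M {\<omega> \<in> space M. c n \<omega> > ereal ((1 + \<epsilon>) * ?L)}"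
  have path: "bounded_variation \<sigma>" "\<sigma> 0 = xinit" "\<sigma> 1 = xgoal"
    using assms(7) by (auto simp: feasible_path_def pathstart_def pathfinish_def)
  have L: "dist xinit xgoal \<le> ?L"
    using arc_length_upper[OF path(1), of "[0, 1]"] path by simp
  show ?thesis
  proof (cases "xinit = xgoal")
    case True
    \<comment> \<open>Here every execution costs 0, so the failure event is empty.\<close>
    have "0 \<le> (1 + \<epsilon>) * ?L" using L True \<open>\<epsilon> > 0\<close> by simp
    then have "{\<omega> \<in> space M. c n \<omega> > ereal ((1 + \<epsilon>) * ?L)} = {}" for n
      using assms(13)[of _ n] True \<open>\<epsilon> > 0\<close> by (auto simp: bfmt_cost_def not_less)
    then have "?p n = 0" for n
      by (simp only: outer_prob_eq_measure sets.empty_sets measure_empty)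
    then show ?thesis by simp
  next
    case ne: False
    have L0: "0 < ?L" using L ne by (meson dist_pos_lt less_le_trans)
    define \<mu> where "\<mu> = measure lborel Xfree"
    define \<zeta> where "\<zeta> = unit_ball_vol ?d"
    define K where "K = 4 * (1 + \<eta>) powr (1 / ?d) * (1 / ?d) powr (1 / ?d) * (\<mu> / \<zeta>) powr (1 / ?d)"
    define r where "r = (\<lambda>n. K * (ln (real n) / real n) powr (1 / ?d))"
    have r: "bfmt_radius Xfree \<eta> n = r n" for n
      by (simp add: bfmt_radius_def r_def K_def \<mu>_def \<zeta>_def Let_def)
    have \<mu>: "0 < \<mu>" using assms(4,5) by (simp add: \<mu>_def measure_def enn2real_positive_iff)
    have \<zeta>: "0 < \<zeta>" by (simp add: \<zeta>_def)
    have K: "0 < K" using \<mu> \<zeta> assms(9) by (simp add: K_def)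
    \<comment> \<open>\<open>1 / 8\<close> keeps the small balls disjoint, and
      \<open>\<epsilon> / 20\<close> keeps the lengthening by detours within half of the allowed
      excess.\<close>
    define \<beta> where "\<beta> = min (1 / 8) (\<epsilon> / 20)"
    have \<beta>: "0 < \<beta>" "\<beta> \<le> 1 / 8" "20 * \<beta> \<le> \<epsilon>" using \<open>\<epsilon> > 0\<close> by (auto simp: \<beta>_def)
    define q where "q = (\<lambda>n. \<zeta> * (r n / 4) ^ DIM('a) / \<mu>)"
    \<comment> \<open>The leading 4 of the radius cancels in \<open>r n / 4\<close>, and the volume
      undoes the root: \<open>n * q n\<close> is the expected number of samples in such a
      ball.\<close>
    have q: "real n * q n = (1 + \<eta>) / ?d * ln (real n)" if n: "2 \<le> n" for n
    proof -
      have root: "(x powr (1 / ?d)) ^ DIM('a) = x" if "0 < x" for x :: real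
        using that by (simp add: powr_power)
      have "(r n / 4) ^ DIM('a) = (1 + \<eta>) * (1 / ?d) * (\<mu> / \<zeta>) * (ln (real n) / real n)"
        using n assms(9) \<mu> \<zeta> by (simp add: r_def K_def power_mult_distrib root)
      then show ?thesis using n \<mu> \<zeta> by (simp add: q_def field_simps)
    qed
    \<comment> \<open>The exponent gained per waypoint: half of the fraction \<open>\<beta>\<close>,
      times the volume ratio of small to large balls, times \<open>n * q n / ln n\<close>.\<close>
    define \<kappa> where "\<kappa> = \<beta> / 2 * (4 * \<beta>) ^ DIM('a) * ((1 + \<eta>) / ?d)"
    have \<kappa>: "0 < \<kappa>" using \<beta> assms(9) by (simp add: \<kappa>_def)
    have lim: "r \<longlonglongrightarrow> 0" unfolding r_def by (rule tendsto_log_ratio_powr) simp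
    show ?thesis
    proof (rule bfmt_failure_bigo[where K = K and \<kappa> = \<kappa> and D = "4 * dist xinit xgoal" and A = "4 * ?L" and r = r])
      have "eventually (\<lambda>n. r n < \<delta> / 2) sequentially" by (rule order_tendstoD[OF lim]) (use assms(6) in simp)
      moreover have "eventually (\<lambda>n. r n < \<epsilon> * ?L / 6) sequentially"
        by (rule order_tendstoD[OF lim]) (use \<open>\<epsilon> > 0\<close> L0 in simp)
      moreover have "eventually (\<lambda>n. 2 \<le> n) sequentially" by (rule eventually_ge_at_top)
      ultimately show "eventually (\<lambda>n. \<exists>N. 4 * dist xinit xgoal \<le> real N * r n \<and> real N * r n \<le> 4 * ?L + r n \<and>
        ?p n \<le> real N * real n powr (- ((1 + \<eta>) / ?d)) + 2 ^ N * real n powr (- \<kappa> * real N)) sequentially"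
      proof eventually_elim
        case (elim n)
        have rn: "0 < r n" using elim(3) K by (simp add: r_def)
        have r_small: "2 * r n \<le> \<delta>" "6 * r n \<le> \<epsilon> * ?L" using elim by simp_all
        obtain N where N: "4 * dist xinit xgoal \<le> real N * r n" "real N * r n \<le> 4 * ?L + r n"
          "?p n \<le> real N * exp (- (real n * q n))
             + 2 ^ N * exp (- (real n * (\<beta> * real N / 2 * ((4 * \<beta>) ^ DIM('a) * q n))))"
          by (rule outer_prob_bfmt_cost_le[OF assms(1,3,4,5,7,8) assms(11)[of n] assms(12)
                assms(13)[of _ n, unfolded r] ne rn r_small \<beta> q_def[unfolded \<zeta>_def \<mu>_def, THEN fun_cong, of n]])
        have "exp (- (real n * q n)) = real n powr (- ((1 + \<eta>) / ?d))"
          using elim(3) q[OF elim(3)] by (simp add: powr_def)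
        moreover have "real n * (\<beta> * real N / 2 * ((4 * \<beta>) ^ DIM('a) * q n)) =
            \<beta> / 2 * (4 * \<beta>) ^ DIM('a) * real N * (real n * q n)" by simp
        then have "exp (- (real n * (\<beta> * real N / 2 * ((4 * \<beta>) ^ DIM('a) * q n)))) = real n powr (- \<kappa> * real N)"
          using elim(3) unfolding q[OF elim(3)] by (simp add: powr_def \<kappa>_def mult_ac)
        ultimately show ?case using N by auto
      qed
    qed (use K \<kappa> ne L0 assms(9) in \<open>auto simp: r_def outer_prob_def\<close>)
  qed
qed

end
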